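(* Let $p\in(0,1]$, $\alpha=1-p$, and $\tau=\frac{\sqrt{1-\alpha}}{L}\gamma$ for $\gamma\in(0,1)$. Let $(\mathbf z_{k+1/2})$ be generated by extragradient with variance reduction (described in the context) with these parameters. Then, for $\mathbf z^{K}=\frac1K\sum_{k=0}^{K-1}\mathbf z_{k+1/2}$, it follows that $$\mathbb E\left[\mathrm{Gap}(\mathbf z^{K})\right]=\mathcal O\left(\frac{L}{\sqrt p\,K}\right).$$ In particular, for $\tau=\frac{\sqrt p}{2L}$, the rate is $$\mathbb E\left[\mathrm{Gap}(\mathbf z^{K})\right]\le\frac{17.5\,L}{\sqrt p\,K}\max_{\mathbf z\in\mathcal C}\|\mathbf z_0-\mathbf z\|^2 .$$
   Context: Let $\mathcal Z$ be a finite-dimensional vector space with Euclidean inner product $\langle\cdot,\cdot\rangle$ and norm $\|\cdot\|$. Let $g:\mathcal Z\to\mathbb R\cup\{+\infty\}$ be proper convex lower semicontinuous, with $\operatorname{dom} g=\{\mathbf z: g(\mathbf z)<+\infty\}$ and $\operatorname{prox}_g(\mathbf x)=\operatorname{argmin}_{\mathbf y}\{g(\mathbf y)+\frac12\|\mathbf y-\mathbf x\|^2\}$. Problem: find $\mathbf z_*\in\mathcal Z$ such that $\langle F(\mathbf z_* ),\mathbf z-\mathbf z_*\rangle+g(\mathbf z)-g(\mathbf z_* )\ge 0$ for all $\mathbf z\in\mathcal Z$. The set of solutions of this problem is assumed nonempty. The operator $F:\operatorname{dom} g\to\mathcal Z$ is monotone: $\langle F(\mathbf x)-F(\mathbf y),\mathbf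 x-\mathbf y\rangle\ge 0$ for all $\mathbf x,\mathbf y$. It has a stochastic oracle $F_\xi$, with $\xi$ distributed according to $Q$, that is unbiased, $F(\mathbf z)=\mathbb E[F_\xi(\mathbf z)]$, and $L$-Lipschitz in mean: $\mathbb E\left[\|F_\xi(\mathbf u)-F_\xi(\mathbf v)\|^2\right]\le L^2\|\mathbf u-\mathbf v\|^2$ for all $\mathbf u,\mathbf v\in\mathcal Z$. Extragradient with variance reduction: given a probability $p$, a probability distribution $Q$, a step size $\tau$, a parameter $\alpha$ and $\mathbf z_0=\mathbf w_0$, for $k=0,1,\dots$: set $\bar{\mathbf z}_k=\alpha\mathbf z_k+(1-\alpha)\mathbf w_k$; $\mathbf z_{k+1/2}=\operatorname{prox}_{\tau g}(\bar{\mathbf z}_k-\tau F(\mathbf w_k))$; draw an index $\xi_k$ according to $Q$; $\mathbf z_{k+1}=\operatorname{prox}_{\tau g}(\bar{\mathbf z}_k-\tau[F(\mathbf w_k)+F_{\xi_k}(\mathbf z_{k+1/2})-F_{\xi_k}(\mathbf w_k)])$; $\mathbf w_{k+1}=\mathbf z_{k+1}$ with probability $p$ and $\mathbf w_{k+1}=\mathbf w_k$ with probability $1-p$. Gap function: $\mathrm{Gap}(\mathbf w)=\max_{\mathbf z\in\mathcal C}\{\langle F(\mathbf z),\mathbf w-\mathbf z\rangle+g(\mathbf w)-g(\mathbf z)\}$, where $\mathcal C$ is a compact subset of $\mathcal Z$ (used to handle the possibility that $\operatorname{dom} g$ is unbounded). *)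

theory Defs
  imports "HOL-Probability.Probability"
begin

section \<open>Proper convex lower semicontinuous functions and the proximal operator\<close>

definition effective_dom :: "('a \<Rightarrow> ereal) \<Rightarrow> 'a set" where
  "effective_dom g = {z. g z < \<infinity>}"

definition proper_fun :: "('a \<Rightarrow> ereal) \<Rightarrow> bool" where
  "proper_fun g \<longleftrightarrow> (\<forall>z. g z \<noteq> -\<infinity>) \<and> effective_dom g \<noteq> {}"

definition convex_ereal :: "('a::real_vector \<Rightarrow> ereal) \<Rightarrow> bool" where
  "convex_ereal g \<longleftrightarrow>
     (\<forall>x y u v. 0 \<le> u \<longrightarrow> 0 \<le> v \<longrightarrow> u + v = 1 \<longrightarrow>
        g (u *\<^sub>R x + v *\<^sub>R y) \<le> ereal u * g x + ereal v * g y)"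

definition lower_semicontinuous :: "('a::topological_space \<Rightarrow> ereal) \<Rightarrow> bool" where
  "lower_semicontinuous g \<longleftrightarrow> (\<forall>x. g x \<le> Liminf (at x) g)"

definition prox :: "('a::real_normed_vector \<Rightarrow> ereal) \<Rightarrow> 'a \<Rightarrow> 'a" where
  "prox g x = arg_min (\<lambda>y. g y + ereal (1/2 * (norm (y - x))\<^sup>2)) (\<lambda>_. True)"

section \<open>The variational inequality and its stochastic oracle\<close>

text \<open>
  \<open>F\<close> and \<open>Fo\<close> are total functions; the values of \<open>F\<close> outside \<open>effective_dom g\<close> are
  unconstrained. \<open>Fo s z\<close> is the oracle value \<open>F_\<xi>(z)\<close> at \<open>\<xi> = s\<close>.
  The mean Lipschitz bound uses the Lebesgue integral in \<open>[0,\<infinity>]\<close>, so that it cannot hold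
  through the value 0 of a non-convergent Bochner integral. Joint measurability makes
  \<open>F_\<xi>(Z)\<close> a random variable for a random point \<open>Z\<close>.
\<close>

locale stochastic_vi =
  prob_space Q for Q :: "'s measure" +
  fixes g :: "'a::euclidean_space \<Rightarrow> ereal"
    and F :: "'a \<Rightarrow> 'a"
    and Fo :: "'s \<Rightarrow> 'a \<Rightarrow> 'a"
    and L :: real
  assumes proper: "proper_fun g"
    and convex: "convex_ereal g"
    and lsc: "lower_semicontinuous g"
    and solvable: "\<exists>zs \<in> effective_dom g. \<forall>z. ereal (F zs \<bullet> (z - zs)) + g z - g zs \<ge> 0"
    and monotone: "\<And>x y. x \<in> effective_dom g \<Longrightarrow> y \<in> effective_dom g \<Longrightarrow>
                     (F x - F y) \<bullet> (x - y) \<ge> 0"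
    and oracle_measurable: "(\<lambda>(s, z). Fo s z) \<in> borel_measurable (Q \<Otimes>\<^sub>M borel)"
    and unbiased: "\<And>z. z \<in> effective_dom g \<Longrightarrow> has_bochner_integral Q (\<lambda>s. Fo s z) (F z)"
    and L_pos: "L > 0"
    and lipschitz_in_mean: "\<And>u v.
          (\<integral>\<^sup>+ s. ennreal ((norm (Fo s u - Fo s v))\<^sup>2) \<partial>Q) \<le> ennreal (L\<^sup>2 * (norm (u - v))\<^sup>2)"

text \<open>
  The supremum is taken in the extended reals; for \<open>w\<close> in the domain of \<open>g\<close>, points of \<open>C\<close>
  outside that domain contribute \<open>-\<infinity>\<close>.
\<close>

definition gap ::
    "('a::euclidean_space \<Rightarrow> ereal) \<Rightarrow> ('a \<Rightarrow> 'a) \<Rightarrow> 'a set \<Rightarrow> 'a \<Rightarrow> ereal" where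
  "gap g F C w = (SUP z\<in>C. ereal (F z \<bullet> (w - z)) + g w - g z)"

section \<open>Extragradient with variance reduction\<close>

definition eg_bar :: "real \<Rightarrow> 'a::real_vector \<Rightarrow> 'a \<Rightarrow> 'a" where
  "eg_bar \<alpha> z w = \<alpha> *\<^sub>R z + (1 - \<alpha>) *\<^sub>R w"

definition eg_extrapolate ::
    "('a::euclidean_space \<Rightarrow> ereal) \<Rightarrow> ('a \<Rightarrow> 'a) \<Rightarrow> real \<Rightarrow> real \<Rightarrow> 'a \<Rightarrow> 'a \<Rightarrow> 'a" where
  "eg_extrapolate g F \<tau> \<alpha> z w =
     prox (\<lambda>y. ereal \<tau> * g y) (eg_bar \<alpha> z w - \<tau> *\<^sub>R F w)"

definition eg_update ::
    "('a::euclidean_space \<Rightarrow> ereal) \<Rightarrow> ('a \<Rightarrow> 'a) \<Rightarrow> ('s \<Rightarrow> 'a \<Rightarrow> 'a) \<Rightarrow> real \<Rightarrow> real \<Rightarrow> 's \<Rightarrow>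
      'a \<Rightarrow> 'a \<Rightarrow> 'a" where
  "eg_update g F Fo \<tau> \<alpha> s z w =
     prox (\<lambda>y. ereal \<tau> * g y)
       (eg_bar \<alpha> z w - \<tau> *\<^sub>R (F w + Fo s (eg_extrapolate g F \<tau> \<alpha> z w) - Fo s w))"

text \<open>
  The pair \<open>(z_k, w_k)\<close>, as a function of the drawn indices \<open>s\<close> and of the outcomes \<open>b\<close> of
  the coin flips that decide whether the snapshot \<open>w\<close> is refreshed.
\<close>

primrec eg_state ::
    "('a::euclidean_space \<Rightarrow> ereal) \<Rightarrow> ('a \<Rightarrow> 'a) \<Rightarrow> ('s \<Rightarrow> 'a \<Rightarrow> 'a) \<Rightarrow> real \<Rightarrow> real \<Rightarrow> 'a \<Rightarrow>
      (nat \<Rightarrow> 's) \<Rightarrow> (nat \<Rightarrow> bool) \<Rightarrow> nat \<Rightarrow> 'a \<times> 'a" where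
  "eg_state g F Fo \<tau> \<alpha> z0 s b 0 = (z0, z0)"
| "eg_state g F Fo \<tau> \<alpha> z0 s b (Suc k) =
     (let (z, w) = eg_state g F Fo \<tau> \<alpha> z0 s b k;
          z' = eg_update g F Fo \<tau> \<alpha> (s k) z w
      in (z', if b k then z' else w))"

text \<open>The half-step iterate \<open>z_{k+1/2}\<close>.\<close>

definition eg_half ::
    "('a::euclidean_space \<Rightarrow> ereal) \<Rightarrow> ('a \<Rightarrow> 'a) \<Rightarrow> ('s \<Rightarrow> 'a \<Rightarrow> 'a) \<Rightarrow> real \<Rightarrow> real \<Rightarrow> 'a \<Rightarrow>
      (nat \<Rightarrow> 's) \<Rightarrow> (nat \<Rightarrow> bool) \<Rightarrow> nat \<Rightarrow> 'a" where
  "eg_half g F Fo \<tau> \<alpha> z0 s b k =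
     (let (z, w) = eg_state g F Fo \<tau> \<alpha> z0 s b k in eg_extrapolate g F \<tau> \<alpha> z w)"

definition eg_average ::
    "('a::euclidean_space \<Rightarrow> ereal) \<Rightarrow> ('a \<Rightarrow> 'a) \<Rightarrow> ('s \<Rightarrow> 'a \<Rightarrow> 'a) \<Rightarrow> real \<Rightarrow> real \<Rightarrow> 'a \<Rightarrow>
      (nat \<Rightarrow> 's) \<Rightarrow> (nat \<Rightarrow> bool) \<Rightarrow> nat \<Rightarrow> 'a" where
  "eg_average g F Fo \<tau> \<alpha> z0 s b K = (1 / real K) *\<^sub>R (\<Sum>k<K. eg_half g F Fo \<tau> \<alpha> z0 s b k)"

text \<open>
  All the draws \<open>\<xi> 0, coin 0, \<xi> 1, coin 1, \<dots>\<close> are mutually independent, with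
  \<open>\<xi> k\<close> distributed as \<open>Q\<close> and \<open>coin k\<close> true with probability \<open>p\<close>: the pairs are
  independent across iterations, and the law of each pair is the product of these two laws.
  Measurability of the draws is part of \<open>indep_vars\<close>.
\<close>

locale eg_sampling =
  prob_space M for M :: "'w measure" +
  fixes Q :: "'s measure"
    and p :: real
    and \<xi> :: "nat \<Rightarrow> 'w \<Rightarrow> 's"
    and coin :: "nat \<Rightarrow> 'w \<Rightarrow> bool"
  assumes p_pos: "0 < p" and p_le_1: "p \<le> 1"
    and law_step: "\<And>k. distr M (Q \<Otimes>\<^sub>M count_space UNIV) (\<lambda>\<omega>. (\<xi> k \<omega>, coin k \<omega>))
                        = Q \<Otimes>\<^sub>M measure_pmf (bernoulli_pmf p)"
    and indep_steps: "indep_vars (\<lambda>_. Q \<Otimes>\<^sub>M count_space UNIV) (\<lambda>k \<omega>. (\<xi> k \<omega>, coin k \<omega>)) UNIV"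

text \<open>
  \<open>expectation_le M X B\<close>: the extended-real random variable \<open>X\<close> is almost surely finite and
  integrable, and its expectation is at most \<open>B\<close>.
\<close>

definition expectation_le :: "'w measure \<Rightarrow> ('w \<Rightarrow> ereal) \<Rightarrow> real \<Rightarrow> bool" where
  "expectation_le M X B \<longleftrightarrow>
     (AE \<omega> in M. \<bar>X \<omega>\<bar> \<noteq> \<infinity>) \<and> integrable M (\<lambda>\<omega>. real_of_ereal (X \<omega>)) \<and>
     (\<integral>\<omega>. real_of_ereal (X \<omega>) \<partial>M) \<le> B"

end

theory Submission
  imports Defs
begin

text \<open>
  Fix a comparison point \<open>y\<close> in the domain of \<open>g\<close>. Adding the variational characterizations of
  the two proximal steps of an iteration bounds the gap integrand at \<open>z_{k+1/2}\<close> by a decrease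
  of weighted squared distances to \<open>y\<close>, minus \<open>\<parallel>z_{k+1} - z_{k+1/2}\<parallel>\<^sup>2\<close> and
  \<open>p \<parallel>z_{k+1/2} - w_k\<parallel>\<^sup>2\<close>, plus two errors: one from replacing \<open>F\<close> by its oracle, one from the
  coin that decides about the snapshot. Both have conditional mean zero at a fixed \<open>y\<close>. But the
  gap takes the supremum over \<open>y\<close> before the expectation, and the maximizing \<open>y\<close> depends on
  the noise.

  The errors depend on \<open>y\<close> only through a linear term \<open>- u_k \<bullet> y\<close>, where \<open>u_k\<close> is a martingale
  difference. This term is removed as in the analysis of online gradient descent: run the
  auxiliary recursion \<open>v_{k+1} = v_k - \<delta> u_k\<close> from \<open>v_0 = z_0\<close> and add
  \<open>\<parallel>v_k - y\<parallel>\<^sup>2 / (2 \<delta>)\<close> to the potential. The price is \<open>- u_k \<bullet> v_k\<close>, of mean zero, and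
  \<open>\<delta>/2 \<parallel>u_k\<parallel>\<^sup>2\<close>; neither involves \<open>y\<close>. So every iteration satisfies
  \<open>2 \<tau> (gap integrand) + \<Psi>_{k+1}(y) \<le> \<Psi>_k(y) + residual_k\<close> for all \<open>y\<close> simultaneously, with a
  residual that is free of \<open>y\<close> (\<open>potential_step\<close>).

  The residual has nonpositive expectation (\<open>residual_expectation\<close>). Its martingale parts vanish;
  the rest is controlled by \<open>a = p E \<parallel>z_{k+1/2} - w_k\<parallel>\<^sup>2\<close> and
  \<open>b = E \<parallel>z_{k+1} - z_{k+1/2}\<parallel>\<^sup>2\<close>. The mean Lipschitz bound and \<open>\<tau>\<^sup>2 L\<^sup>2 = p \<gamma>\<^sup>2\<close> give at
  most \<open>\<gamma> (a + b)\<close> for the cross term of the two proximal steps and \<open>E \<parallel>u_k\<parallel>\<^sup>2 \<le> 12 (a + b)\<close>.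
  With \<open>\<delta> = (1 - \<gamma>) / 6\<close> the total is absorbed by the available \<open>- (a + b)\<close>.

  Summing over \<open>k < K\<close> and using convexity of \<open>g\<close> for the average gives
  \<open>2 \<tau> K Gap \<le> (2 + 3 / (1 - \<gamma>)) sup \<parallel>z_0 - y\<parallel>\<^sup>2 + (sum of the residuals)\<close> along every sample
  path, and then the rate in expectation with the explicit constant
  \<open>(2 + 3 / (1 - \<gamma>)) / (2 \<gamma>)\<close>, which is \<open>8\<close> at \<open>\<gamma> = 1/2\<close>.

  Conditional expectations are expressed by the product law of the current state and the next
  draw (\<open>joint_law\<close>) and Fubini's theorem. Integrability of the residuals rests on the square
  integrability of all iterates, which is propagated by nonexpansiveness of the proximal map and
  Lipschitz continuity of \<open>F\<close> on the domain.
\<close>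

section \<open>Proximal maps of closed convex functions\<close>

text \<open>If no point of \<open>K\<close> were minimal, the open sets \<open>{x. f y < f x}\<close> with \<open>y \<in> K\<close> would cover
  \<open>K\<close>; the best centre of a finite subcover then lies in none of its members.\<close>

lemma lsc_attains_inf:
  fixes f :: "'a::topological_space \<Rightarrow> 'b::linorder"
  assumes K: "compact K" "K \<noteq> {}" and lsc: "\<And>a. open {x. a < f x}"
  shows "\<exists>x\<in>K. \<forall>y\<in>K. f x \<le> f y"
proof (rule ccontr)
  assume "\<not> ?thesis"
  then have "K \<subseteq> (\<Union>y\<in>K. {x. f y < f x})"
    by (auto simp: not_le)
  then obtain T where T: "T \<subseteq> K" "finite T" "K \<subseteq> (\<Union>y\<in>T. {x. f y < f x})"
    by (rule compactE_image[OF K(1) lsc])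
  have "T \<noteq> {}" using T K(2) by auto
  then have "Min (f ` T) \<in> f ` T"
    using T(2) by (intro Min_in) auto
  then obtain t where t: "t \<in> T" "Min (f ` T) = f t"
    by (rule imageE)
  then obtain s where "s \<in> T" "f s < f t"
    using T by blast
  then show False
    using t T(2) Min_le[of "f ` T" "f s"] by auto
qed

locale closed_convex =
  fixes h :: "'a::euclidean_space \<Rightarrow> ereal"
  assumes proper: "proper_fun h"
    and convex: "convex_ereal h"
    and lsc: "lower_semicontinuous h"
begin

abbreviation D :: "'a set" where "D \<equiv> effective_dom h"
abbreviation rh :: "'a \<Rightarrow> real" where "rh z \<equiv> real_of_ereal (h z)"

lemma not_MInf [simp]: "h z \<noteq> -\<infinity>"
  using proper by (auto simp: proper_fun_def)

lemma ereal_rh: "z \<in> D \<Longrightarrow> ereal (rh z) = h z"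
  using not_MInf[of z] by (cases "h z") (auto simp: effective_dom_def)

lemma domE:
  assumes "z \<in> D" obtains r where "h z = ereal r"
  using ereal_rh[OF assms] by metis

lemma outside_dom: "z \<notin> D \<Longrightarrow> h z = \<infinity>"
  by (auto simp: effective_dom_def)

lemma convex_on_rh: "convex_on D rh"
proof -
  have *: "u *\<^sub>R x + v *\<^sub>R y \<in> D \<and> rh (u *\<^sub>R x + v *\<^sub>R y) \<le> u * rh x + v * rh y"
    if "x \<in> D" "y \<in> D" "0 \<le> u" "0 \<le> v" "u + v = 1" for x y u v
  proof -
    have "h (u *\<^sub>R x + v *\<^sub>R y) \<le> ereal u * h x + ereal v * h y"
      using convex that unfolding convex_ereal_def by simp
    also have "\<dots> = ereal (u * rh x + v * rh y)"
      using that(1,2) by (elim domE) simp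
    finally have le: "h (u *\<^sub>R x + v *\<^sub>R y) \<le> ereal (u * rh x + v * rh y)" .
    then have "u *\<^sub>R x + v *\<^sub>R y \<in> D"
      by (auto simp: effective_dom_def)
    then show ?thesis using le by (auto elim!: domE)
  qed
  then show ?thesis
    unfolding convex_on_def convex_def by simp
qed

lemma convex_dom: "convex D"
  using convex_on_rh by (simp add: convex_on_def)

lemma open_superlevel: "open {z. a < h z}"
proof (subst open_subopen, safe)
  fix x assume "a < h x"
  then have "\<forall>\<^sub>F y in at x. a < h y"
    using lsc by (auto simp: le_Liminf_iff lower_semicontinuous_def)
  then obtain S where S: "open S" "x \<in> S" "\<forall>y\<in>S. y \<noteq> x \<longrightarrow> a < h y"
    by (auto simp: eventually_at_topological)
  with \<open>a < h x\<close> show "\<exists>T. open T \<and> x \<in> T \<and> T \<subseteq> {z. a < h z}"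
    by (intro exI[of _ S]) auto
qed

lemma borel_measurable [measurable]: "h \<in> borel_measurable borel"
  by (rule borel_measurableI_greater) (simp add: open_superlevel)

lemma dom_borel [measurable]: "D \<in> sets borel"
  unfolding effective_dom_def by measurable

text \<open>On the unit ball around a point of the domain, lower semicontinuity bounds \<open>h\<close> from
  below; convexity propagates this bound linearly along each ray.\<close>

lemma linear_minorant:
  obtains c b where "b \<ge> 0" "\<And>y. ereal (- c - b * norm y) \<le> h y"
proof -
  obtain y0 where y0: "y0 \<in> D" using proper by (auto simp: proper_fun_def)
  obtain x where x: "\<forall>y\<in>cball y0 1. h x \<le> h y"
    using lsc_attains_inf[of "cball y0 1" h] open_superlevel by auto
  obtain m where m: "ereal m \<le> h x" "m \<le> rh y0"
  proof (cases "h x")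
    case (real r) then show ?thesis using that[of "min r (rh y0)"] by simp
  qed (use that[of "rh y0"] in auto)
  have m': "m \<le> rh y" if "y \<in> D" "y \<in> cball y0 1" for y
  proof -
    have "ereal m \<le> h y" using x m(1) that(2) by (blast intro: order_trans)
    then show ?thesis using that(1) by (auto elim!: domE)
  qed
  define b where "b = rh y0 - m"
  have b: "b \<ge> 0" using m(2) by (simp add: b_def)
  have lb: "m - b * norm (y - y0) \<le> rh y" if y: "y \<in> D" for y
  proof (cases "norm (y - y0) \<le> 1")
    case True
    then have "m \<le> rh y" using y by (intro m') (auto simp: dist_norm norm_minus_commute)
    then show ?thesis using b by (smt (verit) mult_nonneg_nonneg norm_ge_zero)
  next
    case False
    define n where "n = norm (y - y0)"
    have n: "n > 1" using False by (simp add: n_def)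
    define t where "t = 1 / n"
    have t: "0 < t" "t < 1" "t * n = 1" using n by (auto simp: t_def)
    define s where "s = t *\<^sub>R y + (1 - t) *\<^sub>R y0"
    have sy: "s - y0 = t *\<^sub>R (y - y0)" by (simp add: s_def algebra_simps)
    have "norm (s - y0) = 1" using t unfolding sy by (simp add: n_def)
    moreover have "s \<in> D" using convex_dom y y0 t by (auto simp: s_def convex_def)
    ultimately have "m \<le> rh s" by (intro m') (auto simp: dist_norm norm_minus_commute)
    also have "rh s \<le> t * rh y + (1 - t) * rh y0"
      using convex_onD[OF convex_on_rh, of "1 - t" y y0] y y0 t by (simp add: s_def)
    finally have "n * m \<le> n * (t * rh y + (1 - t) * rh y0)" using n by simp
    also have "\<dots> = (t * n) * rh y + (n - t * n) * rh y0" by (simp add: algebra_simps)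
    finally have "n * m \<le> rh y + (n - 1) * rh y0" using t by simp
    then show ?thesis using m(2) unfolding b_def n_def[symmetric] by (simp add: algebra_simps)
  qed
  show ?thesis
  proof (rule that[OF b, of "- m + b * norm y0"])
    fix y
    show "ereal (- (- m + b * norm y0) - b * norm y) \<le> h y"
    proof (cases "y \<in> D")
      case True
      have "b * norm (y - y0) \<le> b * (norm y + norm y0)"
        using b by (intro mult_left_mono norm_triangle_ineq4)
      then have "- (- m + b * norm y0) - b * norm y \<le> rh y"
        using lb[OF True] by (simp add: distrib_left)
      then show ?thesis using True by (auto elim!: domE)
    qed (simp add: outside_dom)
  qed
qed

lemma prox_objective_lsc: "open {y. a < h y + ereal (1/2 * (norm (y - x))\<^sup>2)}"
proof (subst open_subopen, safe)
  define q where "q y = 1/2 * (norm (y - x))\<^sup>2" for y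
  fix y assume "a < h y + ereal (1/2 * (norm (y - x))\<^sup>2)"
  then have "a - ereal (q y) < h y"
    by (simp add: q_def ereal_minus_less)
  then obtain r where r: "a - ereal (q y) < ereal r" "ereal r < h y"
    using ereal_dense2 by blast
  let ?T = "{z. ereal r < h z} \<inter> {z. a < ereal (r + q z)}"
  have "open {z. a < ereal (r + q z)}"
    unfolding q_def by (intro open_Collect_less continuous_intros)
  then have "open ?T" using open_superlevel by blast
  moreover have "y \<in> ?T" using r by (simp add: ereal_minus_less)
  moreover have "?T \<subseteq> {z. a < h z + ereal (q z)}"
    by (auto simp flip: plus_ereal.simps(1) intro: less_le_trans[OF _ add_right_mono[OF less_imp_le]])
  ultimately show "\<exists>T. open T \<and> y \<in> T \<and> T \<subseteq> {y. a < h y + ereal (1/2 * (norm (y - x))\<^sup>2)}"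
    unfolding q_def by blast
qed

text \<open>The proximal map is given by a choice operator, so it has the minimizing property only
  because a minimizer exists: the quadratic term makes the objective coercive, which reduces the
  problem to a compact ball.\<close>

lemma prox_minimizes:
  "h (prox h x) + ereal (1/2 * (norm (prox h x - x))\<^sup>2) \<le> h y + ereal (1/2 * (norm (y - x))\<^sup>2)"
proof -
  define f where "f y = h y + ereal (1/2 * (norm (y - x))\<^sup>2)" for y
  obtain y0 where y0: "y0 \<in> D" using proper by (auto simp: proper_fun_def)
  obtain c b where b: "b \<ge> 0" and cb: "\<And>y. ereal (- c - b * norm y) \<le> h y"
    using linear_minorant by metis
  define v where "v = rh y0 + 1/2 * (norm (y0 - x))\<^sup>2"
  have fy0: "f y0 = ereal v"
    unfolding f_def v_def using y0 by (auto elim!: domE)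
  \<comment> \<open>Outside a ball around \<open>x\<close> of this radius, the quadratic term dominates the minorant.\<close>
  define W where "W = \<bar>c + b * norm x + v\<bar>"
  define R where "R = 2 * b + 1 + 2 * W + norm (y0 - x)"
  have W: "W \<ge> 0" "c + b * norm x + v \<le> W" by (auto simp: W_def)
  have R: "R \<ge> norm (y0 - x)" "R \<ge> 2 * b + 1 + 2 * W" using b W by (auto simp: R_def)
  have out: "f y0 \<le> f y" if "norm (y - x) > R" for y
  proof -
    define n where "n = norm (y - x)"
    have n: "n \<ge> 2 * b + 1 + 2 * W" "n \<ge> 1" using that b W R by (auto simp: n_def)
    have "norm y \<le> n + norm x" using norm_triangle_ineq[of "y - x" x] by (simp add: n_def)
    then have 1: "b * norm y \<le> b * (n + norm x)" using b by (rule mult_left_mono)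
    have 2: "n * (2 * b + 1 + 2 * W) \<le> n * n"
      using n by (intro mult_left_mono) auto
    have 3: "1 * W \<le> n * W"
      using n W by (intro mult_right_mono) auto
    have "v \<le> - c - b * norm y + 1/2 * n\<^sup>2"
      using 1 2 3 W n by (simp add: power2_eq_square algebra_simps)
    then have "ereal v \<le> ereal (- c - b * norm y) + ereal (1/2 * n\<^sup>2)" by simp
    also have "\<dots> \<le> f y" unfolding f_def n_def by (intro add_mono cb order_refl)
    finally show ?thesis by (simp add: fy0)
  qed
  have "y0 \<in> cball x R" using R by (simp add: dist_norm norm_minus_commute)
  have "\<exists>m\<in>cball x R. \<forall>y\<in>cball x R. f m \<le> f y"
    using \<open>y0 \<in> cball x R\<close> unfolding f_def
    by (intro lsc_attains_inf prox_objective_lsc compact_cball) blast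
  then obtain m where m: "m \<in> cball x R" "\<forall>y\<in>cball x R. f m \<le> f y"
    by blast
  have "is_arg_min f (\<lambda>_. True) m"
    unfolding is_arg_min_linorder
  proof safe
    fix y show "f m \<le> f y"
    proof (cases "y \<in> cball x R")
      case False
      then have "f y0 \<le> f y" by (intro out) (auto simp: dist_norm norm_minus_commute)
      with m \<open>y0 \<in> cball x R\<close> show ?thesis by (meson order_trans)
    qed (use m in auto)
  qed
  then have "is_arg_min f (\<lambda>_. True) (arg_min f (\<lambda>_. True))"
    unfolding arg_min_def by (rule someI)
  then have "f (arg_min f (\<lambda>_. True)) \<le> f y"
    by (simp add: is_arg_min_linorder)
  then show ?thesis
    unfolding prox_def f_def by simp
qed

lemma prox_in_dom: "prox h x \<in> D"
proof -
  obtain y0 where y0: "y0 \<in> D" using proper by (auto simp: proper_fun_def)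
  have "h (prox h x) + ereal (1/2 * (norm (prox h x - x))\<^sup>2) < \<infinity>"
    by (rule le_less_trans[OF prox_minimizes[of x y0]]) (use y0 in \<open>auto elim: domE\<close>)
  then show ?thesis by (auto simp: effective_dom_def)
qed

text \<open>The first-order optimality condition: compare the minimizer with the points
  \<open>prox h x + t *\<^sub>R (z - prox h x)\<close> and let \<open>t\<close> tend to \<open>0\<close>.\<close>

lemma prox_variational:
  assumes z: "z \<in> D"
  shows "(prox h x - x) \<bullet> (z - prox h x) + rh z - rh (prox h x) \<ge> 0"
proof -
  let ?P = "prox h x"
  have P: "?P \<in> D" by (rule prox_in_dom)
  have key: "0 \<le> (?P - x) \<bullet> (z - ?P) + rh z - rh ?P + t/2 * (norm (z - ?P))\<^sup>2" if t: "0 < t" "t \<le> 1" for t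
  proof -
    define y where "y = (1 - t) *\<^sub>R ?P + t *\<^sub>R z"
    have yD: "y \<in> D" using convex_dom P z t by (auto simp: y_def convex_def)
    have 1: "rh y \<le> (1 - t) * rh ?P + t * rh z"
      using convex_onD[OF convex_on_rh, of t ?P z] P z t by (simp add: y_def)
    have "rh ?P + 1/2 * (norm (?P - x))\<^sup>2 \<le> rh y + 1/2 * (norm (y - x))\<^sup>2"
      using prox_minimizes[of x y] P yD by (auto elim!: domE)
    moreover have "y - x = (?P - x) + t *\<^sub>R (z - ?P)" by (simp add: y_def algebra_simps)
    moreover have "(norm ((?P - x) + t *\<^sub>R (z - ?P)))\<^sup>2
        = (norm (?P - x))\<^sup>2 + 2 * t * ((?P - x) \<bullet> (z - ?P)) + t\<^sup>2 * (norm (z - ?P))\<^sup>2"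
      unfolding power2_norm_eq_inner
      by (simp add: inner_add_left inner_add_right inner_commute power2_eq_square)
    ultimately have "0 \<le> t * ((?P - x) \<bullet> (z - ?P) + rh z - rh ?P + t/2 * (norm (z - ?P))\<^sup>2)"
      using 1 by (simp add: algebra_simps power2_eq_square)
    then show ?thesis using t by (simp add: zero_le_mult_iff)
  qed
  have "((\<lambda>t. (?P - x) \<bullet> (z - ?P) + rh z - rh ?P + t/2 * (norm (z - ?P))\<^sup>2)
      \<longlongrightarrow> (?P - x) \<bullet> (z - ?P) + rh z - rh ?P + 0/2 * (norm (z - ?P))\<^sup>2) (at_right 0)"
    by (intro tendsto_intros) simp
  moreover have "\<forall>\<^sub>F t::real in at_right 0. 0 \<le> (?P - x) \<bullet> (z - ?P) + rh z - rh ?P + t/2 * (norm (z - ?P))\<^sup>2"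
    using key by (intro eventually_at_rightI[of 0 1]) auto
  ultimately show ?thesis
    using tendsto_lowerbound[of _ _ "at_right (0::real)" 0] by force
qed

text \<open>Add the optimality conditions of the two proximal points, each tested at the other; the
  function values cancel.\<close>

lemma prox_nonexpansive: "norm (prox h x - prox h y) \<le> norm (x - y)"
proof -
  let ?d = "prox h x - prox h y"
  have "0 \<le> (prox h x - x) \<bullet> (prox h y - prox h x) + (prox h y - y) \<bullet> (prox h x - prox h y)"
    using prox_variational[OF prox_in_dom, of x y] prox_variational[OF prox_in_dom, of y x] by linarith
  also have "\<dots> = (x - y) \<bullet> ?d - ?d \<bullet> ?d"
    by (simp add: algebra_simps inner_commute)
  finally have "norm ?d * norm ?d \<le> norm (x - y) * norm ?d"
    using norm_cauchy_schwarz[of "x - y" ?d] by (simp add: power2_norm_eq_inner[symmetric] power2_eq_square)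
  then show ?thesis
    by (cases "norm ?d = 0") (simp_all add: mult_le_cancel_right)
qed

lemma prox_borel [measurable]: "prox h \<in> borel_measurable borel"
proof -
  have "1-lipschitz_on UNIV (prox h)"
    using prox_nonexpansive by (intro lipschitz_onI) (auto simp: dist_norm)
  then show ?thesis
    by (intro borel_measurable_continuous_onI lipschitz_on_continuous_on)
qed

end

lemma closed_convex_scale:
  assumes "closed_convex h" "0 < t"
  shows "closed_convex (\<lambda>y. ereal t * h y)"
    and "effective_dom (\<lambda>y. ereal t * h y) = effective_dom h"
proof -
  interpret closed_convex h by fact
  have fin: "ereal t * h z < \<infinity> \<longleftrightarrow> h z < \<infinity>" for z
    using \<open>0 < t\<close> by (cases "h z") auto
  then show dom: "effective_dom (\<lambda>y. ereal t * h y) = effective_dom h"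
    by (simp add: effective_dom_def)
  have "ereal t * h z \<noteq> - \<infinity>" for z
    using \<open>0 < t\<close> not_MInf[of z] by (cases "h z") auto
  then have "proper_fun (\<lambda>y. ereal t * h y)"
    using proper dom by (auto simp: proper_fun_def)
  moreover have "convex_ereal (\<lambda>y. ereal t * h y)"
    unfolding convex_ereal_def
  proof safe
    fix x y :: 'a and u v :: real
    assume uv: "0 \<le> u" "0 \<le> v" "u + v = 1"
    have "ereal t * h (u *\<^sub>R x + v *\<^sub>R y) \<le> ereal t * (ereal u * h x + ereal v * h y)"
      using convex uv \<open>0 < t\<close> unfolding convex_ereal_def by (intro ereal_mult_left_mono) auto
    also have "\<dots> = ereal t * (ereal u * h x) + ereal t * (ereal v * h y)"
      by (rule ereal_pos_distrib) (use \<open>0 < t\<close> in auto)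
    finally show "ereal t * h (u *\<^sub>R x + v *\<^sub>R y) \<le> ereal u * (ereal t * h x) + ereal v * (ereal t * h y)"
      by (simp add: mult.left_commute)
  qed
  moreover have "lower_semicontinuous (\<lambda>y. ereal t * h y)"
    unfolding lower_semicontinuous_def le_Liminf_iff
  proof safe
    fix x and a :: ereal assume "a < ereal t * h x"
    then have "a / ereal t < h x"
      using \<open>0 < t\<close> by (simp add: ereal_divide_less_iff mult.commute)
    then have "\<forall>\<^sub>F y in at x. a / ereal t < h y"
      using lsc by (simp add: lower_semicontinuous_def le_Liminf_iff)
    then show "\<forall>\<^sub>F y in at x. a < ereal t * h y"
      using \<open>0 < t\<close> by (simp add: ereal_divide_less_iff mult.commute)
  qed
  ultimately show "closed_convex (\<lambda>y. ereal t * h y)" by unfold_locales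
qed

section \<open>Square-integrable random vectors\<close>

definition sq_integrable :: "'w measure \<Rightarrow> ('w \<Rightarrow> 'a::euclidean_space) \<Rightarrow> bool" where
  "sq_integrable M X \<longleftrightarrow> X \<in> borel_measurable M \<and> integrable M (\<lambda>\<omega>. (norm (X \<omega>))\<^sup>2)"

lemma sq_integrable_measurable: "sq_integrable M X \<Longrightarrow> X \<in> borel_measurable M"
  by (simp add: sq_integrable_def)

lemma sq_integrable_norm_sq: "sq_integrable M X \<Longrightarrow> integrable M (\<lambda>\<omega>. (norm (X \<omega>))\<^sup>2)"
  by (simp add: sq_integrable_def)

lemma sq_integrable_bound:
  assumes "sq_integrable M X" "Y \<in> borel_measurable M" "\<And>\<omega>. norm (Y \<omega>) \<le> norm (X \<omega>)"
  shows "sq_integrable M Y"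
proof -
  have "integrable M (\<lambda>\<omega>. (norm (Y \<omega>))\<^sup>2)"
    by (rule Bochner_Integration.integrable_bound[OF sq_integrable_norm_sq[OF assms(1)]])
       (use assms(2,3) in \<open>auto intro!: power_mono\<close>)
  then show ?thesis using assms(2) by (simp add: sq_integrable_def)
qed

lemma sq_integrable_add:
  fixes X Y :: "'a \<Rightarrow> 'b::euclidean_space"
  assumes X: "sq_integrable M X" and Y: "sq_integrable M Y"
  shows "sq_integrable M (\<lambda>\<omega>. X \<omega> + Y \<omega>)"
proof -
  note [measurable] = sq_integrable_measurable[OF X] sq_integrable_measurable[OF Y]
  have le: "(norm (x + y))\<^sup>2 \<le> 2 * (norm x)\<^sup>2 + 2 * (norm y)\<^sup>2" for x y :: 'b
  proof -
    have "(norm (x + y))\<^sup>2 + (norm (x - y))\<^sup>2 = 2 * (norm x)\<^sup>2 + 2 * (norm y)\<^sup>2"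
      unfolding power2_norm_eq_inner by (simp add: algebra_simps inner_commute)
    then show ?thesis using zero_le_power2[of "norm (x - y)"] by linarith
  qed
  have "integrable M (\<lambda>\<omega>. 2 * (norm (X \<omega>))\<^sup>2 + 2 * (norm (Y \<omega>))\<^sup>2)"
    using X Y by (simp add: sq_integrable_def)
  then have "integrable M (\<lambda>\<omega>. (norm (X \<omega> + Y \<omega>))\<^sup>2)"
    by (rule Bochner_Integration.integrable_bound) (use le in auto)
  then show ?thesis by (simp add: sq_integrable_def)
qed

lemma sq_integrable_scaleR:
  assumes "sq_integrable M X" shows "sq_integrable M (\<lambda>\<omega>. c *\<^sub>R X \<omega>)"
  using assms by (auto simp: sq_integrable_def power_mult_distrib)

lemma sq_integrable_minus:
  assumes "sq_integrable M X" "sq_integrable M Y" shows "sq_integrable M (\<lambda>\<omega>. X \<omega> - Y \<omega>)"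
  using sq_integrable_add[OF assms(1) sq_integrable_scaleR[OF assms(2), of "-1"]] by simp

lemma sq_integrable_norm:
  assumes "sq_integrable M X" shows "sq_integrable M (\<lambda>\<omega>. norm (X \<omega>))"
  using assms by (auto simp: sq_integrable_def)

lemma sq_integrable_const:
  assumes "finite_measure M" shows "sq_integrable M (\<lambda>\<omega>. c)"
  using assms by (auto simp: sq_integrable_def intro: finite_measure.integrable_const)

lemma sq_integrable_sum:
  assumes "finite_measure M" "\<And>i. i \<in> I \<Longrightarrow> sq_integrable M (X i)"
  shows "sq_integrable M (\<lambda>\<omega>. \<Sum>i\<in>I. X i \<omega>)"
  using assms(2)
  by (induction I rule: infinite_finite_induct)
     (auto intro!: sq_integrable_add sq_integrable_const[OF assms(1)])

lemma integrable_inner_sq_integrable: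
  assumes X: "sq_integrable M X" and Y: "sq_integrable M Y"
  shows "integrable M (\<lambda>\<omega>. X \<omega> \<bullet> Y \<omega>)"
proof -
  have "(\<lambda>\<omega>. X \<omega> \<bullet> Y \<omega>) = (\<lambda>\<omega>. 1/2 * ((norm (X \<omega> + Y \<omega>))\<^sup>2 - (norm (X \<omega>))\<^sup>2 - (norm (Y \<omega>))\<^sup>2))"
    unfolding power2_norm_eq_inner by (simp add: fun_eq_iff algebra_simps inner_commute)
  moreover have "integrable M (\<lambda>\<omega>. 1/2 * ((norm (X \<omega> + Y \<omega>))\<^sup>2 - (norm (X \<omega>))\<^sup>2 - (norm (Y \<omega>))\<^sup>2))"
    using X Y sq_integrable_add[OF X Y] by (simp add: sq_integrable_def)
  ultimately show ?thesis by (simp only:)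
qed

lemma (in finite_measure) integrable_sq_integrable:
  assumes X: "sq_integrable M X" shows "integrable M X"
proof -
  have "integrable M (\<lambda>\<omega>. (\<Sum>i\<in>Basis. (X \<omega> \<bullet> i) *\<^sub>R i))"
    using integrable_inner_sq_integrable[OF X sq_integrable_const[OF finite_measure_axioms]] by auto
  then show ?thesis by (simp add: euclidean_representation)
qed

lemma sq_integrable_nn_integral:
  assumes "X \<in> borel_measurable M" "(\<integral>\<^sup>+\<omega>. ennreal ((norm (X \<omega>))\<^sup>2) \<partial>M) < \<infinity>"
  shows "sq_integrable M X"
  unfolding sq_integrable_def using assms by (auto intro!: integrableI_bounded)

text \<open>Jensen's inequality for the squared norm, as nonnegativity of the variance.\<close>

lemma (in prob_space) norm_expectation_sq_le:
  fixes X :: "'a \<Rightarrow> 'b::euclidean_space"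
  assumes X: "sq_integrable M X"
  shows "(norm (expectation X))\<^sup>2 \<le> expectation (\<lambda>\<omega>. (norm (X \<omega>))\<^sup>2)"
proof -
  define m where "m = expectation X"
  note int = integrable_sq_integrable[OF X]
  have "0 \<le> expectation (\<lambda>\<omega>. (norm (X \<omega> - m))\<^sup>2)" by simp
  also have "\<dots> = expectation (\<lambda>\<omega>. (norm (X \<omega>))\<^sup>2 - 2 * (X \<omega> \<bullet> m) + (norm m)\<^sup>2)"
    unfolding power2_norm_eq_inner by (simp add: algebra_simps inner_commute)
  also have "\<dots> = expectation (\<lambda>\<omega>. (norm (X \<omega>))\<^sup>2) - 2 * (m \<bullet> m) + (norm m)\<^sup>2"
    using int sq_integrable_norm_sq[OF X] by (simp add: m_def prob_space)
  finally show ?thesis by (simp add: m_def power2_norm_eq_inner)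
qed

section \<open>The stochastic oracle\<close>

context stochastic_vi begin

abbreviation dom_g :: "'a set" where "dom_g \<equiv> effective_dom g"

lemma oracle_compose:
  assumes "f \<in> measurable N Q" "h \<in> measurable N borel"
  shows "(\<lambda>x. Fo (f x) (h x)) \<in> borel_measurable N"
  using measurable_compose[OF measurable_Pair[OF assms] oracle_measurable] by simp

lemma oracle_measurable_fixed [measurable]: "(\<lambda>s. Fo s u) \<in> borel_measurable Q"
  by (rule oracle_compose) auto

lemma oracle_difference:
  shows "sq_integrable Q (\<lambda>s. Fo s u - Fo s v)"
    and "(\<integral>s. (norm (Fo s u - Fo s v))\<^sup>2 \<partial>Q) \<le> L\<^sup>2 * (norm (u - v))\<^sup>2"
proof -
  show *: "sq_integrable Q (\<lambda>s. Fo s u - Fo s v)"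
    by (rule sq_integrable_nn_integral)
       (auto intro: le_less_trans[OF lipschitz_in_mean])
  have "ennreal (\<integral>s. (norm (Fo s u - Fo s v))\<^sup>2 \<partial>Q) \<le> ennreal (L\<^sup>2 * (norm (u - v))\<^sup>2)"
    using lipschitz_in_mean[of u v] sq_integrable_norm_sq[OF *] by (simp add: nn_integral_eq_integral)
  then show "(\<integral>s. (norm (Fo s u - Fo s v))\<^sup>2 \<partial>Q) \<le> L\<^sup>2 * (norm (u - v))\<^sup>2"
    by (subst (asm) ennreal_le_iff) auto
qed

lemma mean_oracle_difference:
  assumes "u \<in> dom_g" "v \<in> dom_g"
  shows "(\<integral>s. Fo s u - Fo s v \<partial>Q) = F u - F v"
  using has_bochner_integral_diff[OF unbiased[OF assms(1)] unbiased[OF assms(2)]]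
  by (rule has_bochner_integral_integral_eq)

text \<open>\<open>F\<close> inherits the constant of the oracle, as the norm of a mean is at most the root mean
  square.\<close>

lemma F_lipschitz:
  assumes "u \<in> dom_g" "v \<in> dom_g"
  shows "norm (F u - F v) \<le> L * norm (u - v)"
proof -
  have "(norm (F u - F v))\<^sup>2 \<le> (L * norm (u - v))\<^sup>2"
    using norm_expectation_sq_le[OF oracle_difference(1), of u v] oracle_difference(2)[of u v]
    unfolding mean_oracle_difference[OF assms] by (simp add: power_mult_distrib)
  then show ?thesis using L_pos by (simp add: power2_le_iff_abs_le)
qed

end

section \<open>Independence of the current state and the next draw\<close>

context eg_sampling begin

abbreviation step_space :: "('s \<times> bool) measure" where
  "step_space \<equiv> Q \<Otimes>\<^sub>M count_space UNIV"

lemma step_measurable: "(\<lambda>\<omega>. (\<xi> k \<omega>, coin k \<omega>)) \<in> measurable M step_space"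
  using indep_steps by (auto simp: indep_vars_def)

lemma xi_measurable [measurable]: "\<xi> k \<in> measurable M Q"
  using measurable_compose[OF step_measurable measurable_fst] by simp

lemma coin_measurable [measurable]: "coin k \<in> measurable M (count_space UNIV)"
  using measurable_compose[OF step_measurable measurable_snd] by simp

text \<open>Independence of the draws is a statement about families of draws. It applies to the states
  of a recursion once these are exhibited as measurable functions of the finite history.\<close>

lemma recursion_from_history:
  fixes st :: "nat \<Rightarrow> 'w \<Rightarrow> 'b"
  assumes T: "T \<in> measurable (N \<Otimes>\<^sub>M step_space) N" and s0: "s0 \<in> space N"
    and st_0: "\<And>\<omega>. st 0 \<omega> = s0"
    and st_Suc: "\<And>k \<omega>. st (Suc k) \<omega> = T (st k \<omega>, (\<xi> k \<omega>, coin k \<omega>))"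
  shows "\<exists>\<sigma> \<in> measurable (PiM {..<k} (\<lambda>_. step_space)) N.
      \<forall>\<omega>. st k \<omega> = \<sigma> (\<lambda>i\<in>{..<k}. (\<xi> i \<omega>, coin i \<omega>))"
proof (induction k)
  case 0
  show ?case by (rule bexI[of _ "\<lambda>_. s0"]) (auto simp: st_0 s0)
next
  case (Suc k)
  then obtain \<sigma> where \<sigma>: "\<sigma> \<in> measurable (PiM {..<k} (\<lambda>_. step_space)) N"
      "\<And>\<omega>. st k \<omega> = \<sigma> (\<lambda>i\<in>{..<k}. (\<xi> i \<omega>, coin i \<omega>))"
    by blast
  have "(\<lambda>h. restrict h {..<k}) \<in> measurable (PiM {..<Suc k} (\<lambda>_. step_space)) (PiM {..<k} (\<lambda>_. step_space))"
    by (rule measurable_restrict_subset) auto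
  then have r: "(\<lambda>h. \<sigma> (restrict h {..<k})) \<in> measurable (PiM {..<Suc k} (\<lambda>_. step_space)) N"
    using \<sigma>(1) by (rule measurable_compose)
  have "(\<lambda>h. h k) \<in> measurable (PiM {..<Suc k} (\<lambda>_. step_space)) step_space"
    by (rule measurable_component_singleton) simp
  from measurable_compose[OF measurable_Pair[OF r this] T]
  show ?case
    by (rule bexI[rotated]) (auto simp: st_Suc \<sigma>(2) restrict_restrict Int_absorb1 Int_absorb2 lessThan_subset_iff intro!: arg_cong[where f=T] arg_cong[where f=\<sigma>])
qed

end

locale sampled_recursion = eg_sampling M Q p \<xi> coin
  for M :: "'w measure" and Q :: "'s measure" and p \<xi> coin +
  fixes st :: "nat \<Rightarrow> 'w \<Rightarrow> 'b" and N :: "'b measure" and T :: "'b \<times> 's \<times> bool \<Rightarrow> 'b" and s0 :: 'b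
  assumes T: "T \<in> measurable (N \<Otimes>\<^sub>M step_space) N" and s0: "s0 \<in> space N"
    and st_0: "\<And>\<omega>. st 0 \<omega> = s0"
    and st_Suc: "\<And>k \<omega>. st (Suc k) \<omega> = T (st k \<omega>, (\<xi> k \<omega>, coin k \<omega>))"
begin

lemma state_measurable: "st k \<in> measurable M N"
proof -
  obtain \<sigma> where \<sigma>: "\<sigma> \<in> measurable (PiM {..<k} (\<lambda>_. step_space)) N"
      "\<And>\<omega>. st k \<omega> = \<sigma> (\<lambda>i\<in>{..<k}. (\<xi> i \<omega>, coin i \<omega>))"
    using recursion_from_history[of T N s0 st k, OF T s0 st_0 st_Suc] by blast
  have "(\<lambda>\<omega>. \<lambda>i\<in>{..<k}. (\<xi> i \<omega>, coin i \<omega>)) \<in> measurable M (PiM {..<k} (\<lambda>_. step_space))"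
    by (rule measurable_restrict) (rule step_measurable)
  from measurable_compose[OF this \<sigma>(1)] show ?thesis
    by (simp add: \<sigma>(2)[symmetric])
qed

text \<open>This product law replaces conditioning on the past: integrating a function of state and
  draw first over the draw, at a frozen state, is taking its conditional expectation.\<close>

lemma joint_law:
  "distr M (N \<Otimes>\<^sub>M step_space) (\<lambda>\<omega>. (st k \<omega>, (\<xi> k \<omega>, coin k \<omega>)))
     = distr M N (st k) \<Otimes>\<^sub>M (Q \<Otimes>\<^sub>M measure_pmf (bernoulli_pmf p))"
proof -
  let ?H = "PiM {..<k} (\<lambda>_. step_space)" and ?K = "PiM {k} (\<lambda>_. step_space)"
  let ?h = "\<lambda>\<omega>. \<lambda>i\<in>{..<k}. (\<xi> i \<omega>, coin i \<omega>)" and ?s = "\<lambda>\<omega>. \<lambda>i\<in>{k}. (\<xi> i \<omega>, coin i \<omega>)"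
  obtain \<sigma> where \<sigma> [measurable]: "\<sigma> \<in> measurable ?H N" and st: "\<And>\<omega>. st k \<omega> = \<sigma> (?h \<omega>)"
    using recursion_from_history[of T N s0 st k, OF T s0 st_0 st_Suc] by blast
  have ind: "indep_var ?H ?h ?K ?s"
    by (rule indep_var_restrict[OF indep_steps]) auto
  have h [measurable]: "?h \<in> measurable M ?H" and s [measurable]: "?s \<in> measurable M ?K"
    by (auto intro!: measurable_restrict step_measurable)
  have c [measurable]: "(\<lambda>x. x k) \<in> measurable ?K step_space"
    by (rule measurable_component_singleton) simp
  have st': "distr (distr M ?H ?h) N \<sigma> = distr M N (st k)"
    by (subst distr_distr) (auto simp: comp_def st[symmetric])
  have step': "distr (distr M ?K ?s) step_space (\<lambda>x. x k) = Q \<Otimes>\<^sub>M measure_pmf (bernoulli_pmf p)"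
    unfolding law_step[of k, symmetric] by (subst distr_distr) (auto simp: comp_def)
  interpret S: prob_space "distr (distr M ?K ?s) step_space (\<lambda>x. x k)"
    by (intro prob_space.prob_space_distr prob_space_axioms) auto
  have "distr M N (st k) \<Otimes>\<^sub>M (Q \<Otimes>\<^sub>M measure_pmf (bernoulli_pmf p))
      = distr (distr M ?H ?h) N \<sigma> \<Otimes>\<^sub>M distr (distr M ?K ?s) step_space (\<lambda>x. x k)"
    by (simp only: st' step')
  also have "\<dots> = distr (distr M ?H ?h \<Otimes>\<^sub>M distr M ?K ?s) (N \<Otimes>\<^sub>M step_space) (\<lambda>(x, y). (\<sigma> x, y k))"
    by (rule pair_measure_distr) (auto intro: S.sigma_finite_measure_axioms)
  also have "distr M ?H ?h \<Otimes>\<^sub>M distr M ?K ?s = distr M (?H \<Otimes>\<^sub>M ?K) (\<lambda>\<omega>. (?h \<omega>, ?s \<omega>))"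
    using ind by (simp add: indep_var_distribution_eq)
  also have "distr \<dots> (N \<Otimes>\<^sub>M step_space) (\<lambda>(x, y). (\<sigma> x, y k))
      = distr M (N \<Otimes>\<^sub>M step_space) (\<lambda>\<omega>. (st k \<omega>, (\<xi> k \<omega>, coin k \<omega>)))"
    by (subst distr_distr) (auto simp: comp_def st)
  finally show ?thesis by simp
qed

lemma index_law: "distr (Q \<Otimes>\<^sub>M measure_pmf (bernoulli_pmf p)) Q fst = Q"
  by (rule prob_space.distr_pair_fst) (rule measure_pmf.prob_space_axioms)

lemma prob_space_Q: "prob_space Q"
proof -
  have "prob_space (Q \<Otimes>\<^sub>M measure_pmf (bernoulli_pmf p))"
    unfolding law_step[of 0, symmetric] by (rule prob_space_distr) (rule step_measurable)
  then have "prob_space (distr (Q \<Otimes>\<^sub>M measure_pmf (bernoulli_pmf p)) Q fst)"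
    by (rule prob_space.prob_space_distr) simp
  then show ?thesis by (simp add: index_law)
qed

lemma joint_law_index:
  "distr M (N \<Otimes>\<^sub>M Q) (\<lambda>\<omega>. (st k \<omega>, \<xi> k \<omega>)) = distr M N (st k) \<Otimes>\<^sub>M Q"
proof -
  let ?R = "Q \<Otimes>\<^sub>M measure_pmf (bernoulli_pmf p)"
  note [measurable] = state_measurable
  interpret Q: prob_space Q by (rule prob_space_Q)
  have "distr M N (st k) \<Otimes>\<^sub>M Q = distr (distr M N (st k)) N (\<lambda>x. x) \<Otimes>\<^sub>M distr ?R Q fst"
    by (simp add: index_law distr_id2)
  also have "\<dots> = distr (distr M N (st k) \<Otimes>\<^sub>M ?R) (N \<Otimes>\<^sub>M Q) (\<lambda>(x, y). (x, fst y))"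
    by (rule pair_measure_distr) (auto simp: index_law intro: Q.sigma_finite_measure_axioms)
  also have "\<dots> = distr M (N \<Otimes>\<^sub>M Q) (\<lambda>\<omega>. (st k \<omega>, \<xi> k \<omega>))"
    unfolding joint_law[symmetric] by (subst distr_distr) (auto simp: comp_def)
  finally show ?thesis by simp
qed

lemma nn_integral_fresh_index:
  assumes f: "f \<in> borel_measurable (N \<Otimes>\<^sub>M Q)"
  shows "(\<integral>\<^sup>+\<omega>. f (st k \<omega>, \<xi> k \<omega>) \<partial>M) = (\<integral>\<^sup>+\<omega>. (\<integral>\<^sup>+x. f (st k \<omega>, x) \<partial>Q) \<partial>M)"
proof -
  interpret Q: prob_space Q by (rule prob_space_Q)
  note [measurable] = state_measurable f
  have "(\<integral>\<^sup>+\<omega>. f (st k \<omega>, \<xi> k \<omega>) \<partial>M) = (\<integral>\<^sup>+y. f y \<partial>distr M (N \<Otimes>\<^sub>M Q) (\<lambda>\<omega>. (st k \<omega>, \<xi> k \<omega>)))"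
    by (rule nn_integral_distr[symmetric]) auto
  also have "\<dots> = (\<integral>\<^sup>+s. (\<integral>\<^sup>+x. f (s, x) \<partial>Q) \<partial>distr M N (st k))"
    unfolding joint_law_index by (rule Q.nn_integral_fst[symmetric]) simp
  also have "\<dots> = (\<integral>\<^sup>+\<omega>. (\<integral>\<^sup>+x. f (st k \<omega>, x) \<partial>Q) \<partial>M)"
    by (rule nn_integral_distr) auto
  finally show ?thesis .
qed

lemma expectation_fresh_index:
  fixes f :: "'b \<times> 's \<Rightarrow> real"
  assumes f: "f \<in> borel_measurable (N \<Otimes>\<^sub>M Q)" and int: "integrable M (\<lambda>\<omega>. f (st k \<omega>, \<xi> k \<omega>))"
  shows "expectation (\<lambda>\<omega>. f (st k \<omega>, \<xi> k \<omega>)) = expectation (\<lambda>\<omega>. \<integral>x. f (st k \<omega>, x) \<partial>Q)"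
proof -
  interpret Q: prob_space Q by (rule prob_space_Q)
  interpret P: prob_space "distr M N (st k)" by (rule prob_space_distr[OF state_measurable])
  interpret PQ: pair_sigma_finite "distr M N (st k)" Q by unfold_locales
  note [measurable] = state_measurable f
  have "integrable (distr M N (st k) \<Otimes>\<^sub>M Q) f"
    unfolding joint_law_index[symmetric] by (subst integrable_distr_eq) (use int in auto)
  from PQ.integral_fst'[OF this]
  have "(\<integral>y. f y \<partial>distr M (N \<Otimes>\<^sub>M Q) (\<lambda>\<omega>. (st k \<omega>, \<xi> k \<omega>))) = (\<integral>s. (\<integral>x. f (s, x) \<partial>Q) \<partial>distr M N (st k))"
    unfolding joint_law_index by simp
  then show ?thesis by (simp add: integral_distr)
qed

lemma expectation_fresh_coin:
  fixes f :: "'b \<times> 's \<Rightarrow> real"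
  assumes f: "f \<in> borel_measurable (N \<Otimes>\<^sub>M Q)" and int: "integrable M (\<lambda>\<omega>. f (st k \<omega>, \<xi> k \<omega>))"
  shows "expectation (\<lambda>\<omega>. (of_bool (coin k \<omega>) - p) * f (st k \<omega>, \<xi> k \<omega>)) = 0"
proof -
  let ?B = "measure_pmf (bernoulli_pmf p)"
  interpret Q: prob_space Q by (rule prob_space_Q)
  interpret P: prob_space "distr M N (st k)" by (rule prob_space_distr[OF state_measurable])
  interpret QB: pair_prob_space Q ?B by unfold_locales
  interpret PQB: pair_sigma_finite "distr M N (st k)" "Q \<Otimes>\<^sub>M ?B" by unfold_locales
  note [measurable] = state_measurable f
  define F where "F = (\<lambda>(s, x, b). (of_bool b - p) * f (s, x))"
  have F [measurable]: "F \<in> borel_measurable (N \<Otimes>\<^sub>M step_space)"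
    unfolding F_def by measurable
  have "integrable M (\<lambda>\<omega>. F (st k \<omega>, \<xi> k \<omega>, coin k \<omega>))"
  proof (rule Bochner_Integration.integrable_bound[OF int])
    show "AE \<omega> in M. norm (F (st k \<omega>, \<xi> k \<omega>, coin k \<omega>)) \<le> norm (f (st k \<omega>, \<xi> k \<omega>))"
      using p_pos p_le_1 by (auto simp: F_def abs_mult of_bool_def intro!: mult_left_le_one_le AE_I2)
  qed auto
  then have "integrable (distr M N (st k) \<Otimes>\<^sub>M (Q \<Otimes>\<^sub>M ?B)) F"
    unfolding joint_law[symmetric] by (subst integrable_distr_eq) auto
  note FI = PQB.integral_fst'[OF this]
  have inner: "(\<integral>y. F (s, y) \<partial>(Q \<Otimes>\<^sub>M ?B)) = 0" for s
  proof (cases "integrable (Q \<Otimes>\<^sub>M ?B) (\<lambda>y. F (s, y))")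
    case True
    \<comment> \<open>The coin is integrated innermost, with state and index frozen.\<close>
    have "(\<integral>b. (of_bool b - p) * c \<partial>?B) = 0" for c
      using p_pos p_le_1 by (simp add: integral_measure_pmf_real[of UNIV] UNIV_bool algebra_simps)
    then have "(\<integral>b. F (s, x, b) \<partial>?B) = 0" for x
      by (simp add: F_def)
    then show ?thesis using QB.integral_fst'[OF True] by simp
  qed (rule not_integrable_integral_eq)
  have "expectation (\<lambda>\<omega>. F (st k \<omega>, \<xi> k \<omega>, coin k \<omega>))
      = (\<integral>y. F y \<partial>distr M (N \<Otimes>\<^sub>M step_space) (\<lambda>\<omega>. (st k \<omega>, (\<xi> k \<omega>, coin k \<omega>))))"
    by (rule integral_distr[symmetric]) auto
  also have "\<dots> = 0" unfolding joint_law FI[symmetric] inner by simp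
  finally show ?thesis by (simp add: F_def)
qed

end

section \<open>Algebra of one iteration\<close>

text \<open>Here \<open>h\<close> is the extrapolated point, \<open>a = F w\<close>, \<open>f = F h\<close>, and \<open>d\<close> is the sampled difference
  \<open>F_\<xi>(h) - F_\<xi>(w)\<close>. Twice the two proximal inequalities and \<open>(1 - p) \<parallel>h - z\<parallel>\<^sup>2\<close> sum to exactly
  the difference of the two sides: expanding the inner products with the averaged centre produces
  \<open>\<parallel>z' - z\<parallel>\<^sup>2\<close> and \<open>\<parallel>z' - w\<parallel>\<^sup>2\<close> once with each sign.\<close>

lemma extragradient_inequality:
  fixes z w h z' y a d f :: "'a::euclidean_space"
  assumes extrapolate: "0 \<le> (h - (eg_bar (1 - p) z w - \<tau> *\<^sub>R a)) \<bullet> (z' - h) + \<tau> * gz' - \<tau> * gh"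
    and update: "0 \<le> (z' - (eg_bar (1 - p) z w - \<tau> *\<^sub>R (a + d))) \<bullet> (y - z') + \<tau> * gy - \<tau> * gz'"
    and p: "p \<le> 1"
  shows "2 * \<tau> * (f \<bullet> (h - y) + gh - gy) + (norm (z' - y))\<^sup>2
      \<le> (1 - p) * (norm (z - y))\<^sup>2 + p * (norm (w - y))\<^sup>2
        + 2 * \<tau> * ((f - a - d) \<bullet> (h - y)) - 2 * \<tau> * (d \<bullet> (z' - h))
        - (norm (z' - h))\<^sup>2 - p * (norm (h - w))\<^sup>2" (is "?l \<le> ?r")
proof -
  have "?r - ?l = 2 * ((h - (eg_bar (1 - p) z w - \<tau> *\<^sub>R a)) \<bullet> (z' - h) + \<tau> * gz' - \<tau> * gh)
     + 2 * ((z' - (eg_bar (1 - p) z w - \<tau> *\<^sub>R (a + d))) \<bullet> (y - z') + \<tau> * gy - \<tau> * gz')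
     + (1 - p) * (norm (h - z))\<^sup>2"
    unfolding power2_norm_eq_inner eg_bar_def by (simp add: algebra_simps inner_commute)
  also have "0 \<le> \<dots>"
    using extrapolate update p by (intro add_nonneg_nonneg mult_nonneg_nonneg) auto
  finally show ?thesis by simp
qed

text \<open>The mean part makes the potential telescope: \<open>p \<parallel>z' - y\<parallel>\<^sup>2\<close> completes \<open>(1 - p) \<parallel>z' - y\<parallel>\<^sup>2\<close>
  to the left side of \<open>extragradient_inequality\<close>, and \<open>(1 - p) \<parallel>w - y\<parallel>\<^sup>2\<close> completes the
  \<open>p \<parallel>w - y\<parallel>\<^sup>2\<close> on its right. The deviation of the coin from its mean multiplies a term that is
  affine in \<open>y\<close>.\<close>

lemma refresh_identity:
  fixes z' w y :: "'a::euclidean_space"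
  shows "(norm ((if b then z' else w) - y))\<^sup>2 = p * (norm (z' - y))\<^sup>2 + (1 - p) * (norm (w - y))\<^sup>2
      + (of_bool b - p) * ((norm z')\<^sup>2 - (norm w)\<^sup>2 - 2 * ((z' - w) \<bullet> y))"
  unfolding power2_norm_eq_inner by (cases b) (simp_all add: algebra_simps inner_commute)

text \<open>The descent recursion on \<open>v\<close> is chosen such that it produces \<open>u \<bullet> y\<close>, which cancels the
  \<open>y\<close>-dependent part \<open>- u \<bullet> y\<close> of the errors.\<close>

lemma regularizer_identity:
  fixes v u y :: "'a::euclidean_space"
  assumes "\<delta> > 0"
  shows "(norm (v - \<delta> *\<^sub>R u - y))\<^sup>2 / (2 * \<delta>)
     = (norm (v - y))\<^sup>2 / (2 * \<delta>) - u \<bullet> v + u \<bullet> y + \<delta> / 2 * (norm u)\<^sup>2"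
proof -
  have "(norm (v - \<delta> *\<^sub>R u - y))\<^sup>2 = (norm (v - y))\<^sup>2 + (2 * \<delta>) * (- u \<bullet> v + u \<bullet> y + \<delta> / 2 * (norm u)\<^sup>2)"
    unfolding power2_norm_eq_inner by (simp add: algebra_simps inner_commute)
  then show ?thesis using assms by (simp add: add_divide_distrib)
qed

text \<open>The vector \<open>u\<close> collects the coefficients of \<open>- y\<close> in the oracle error
  \<open>2 \<tau> ((f - a - d) \<bullet> (h - y))\<close> and in the coin error of \<open>refresh_identity\<close>. Nothing that
  depends on \<open>y\<close> remains on the right outside the potential.\<close>

lemma potential_inequality:
  fixes z w h z' y a d f v :: "'a::euclidean_space"
  assumes "0 \<le> (h - (eg_bar (1 - p) z w - \<tau> *\<^sub>R a)) \<bullet> (z' - h) + \<tau> * gz' - \<tau> * gh"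
    and "0 \<le> (z' - (eg_bar (1 - p) z w - \<tau> *\<^sub>R (a + d))) \<bullet> (y - z') + \<tau> * gy - \<tau> * gz'"
    and p: "p \<le> 1" and \<delta>: "\<delta> > 0"
    and u: "u = (2 * \<tau>) *\<^sub>R (f - a - d) + (2 * (of_bool b - p)) *\<^sub>R (z' - w)"
  shows "2 * \<tau> * (f \<bullet> (h - y) + gh - gy)
      + ((1 - p) * (norm (z' - y))\<^sup>2 + (norm ((if b then z' else w) - y))\<^sup>2 + (norm (v - \<delta> *\<^sub>R u - y))\<^sup>2 / (2 * \<delta>))
    \<le> ((1 - p) * (norm (z - y))\<^sup>2 + (norm (w - y))\<^sup>2 + (norm (v - y))\<^sup>2 / (2 * \<delta>))
      + (2 * \<tau> * ((f - a - d) \<bullet> h) + (of_bool b - p) * ((norm z')\<^sup>2 - (norm w)\<^sup>2) - u \<bullet> v + \<delta> / 2 * (norm u)\<^sup>2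
         - 2 * \<tau> * (d \<bullet> (z' - h)) - (norm (z' - h))\<^sup>2 - p * (norm (h - w))\<^sup>2)"
proof -
  have uy: "u \<bullet> y = 2 * \<tau> * ((f - a - d) \<bullet> y) + 2 * (of_bool b - p) * ((z' - w) \<bullet> y)"
    by (simp add: u inner_add_left)
  show ?thesis
    using extragradient_inequality[OF assms(1-3), of f]
    unfolding refresh_identity[of b z' w y p] regularizer_identity[OF \<delta>] uy
    by (simp add: algebra_simps)
qed

text \<open>The bound splits the residual into parts whose expectations are accessible: an oracle error
  \<open>e - d\<close> against a function of the current state, the centred coin times a function of state and
  index, and squared norms. For the squares that are hidden in \<open>\<parallel>u\<parallel>\<^sup>2\<close> it uses
  \<open>\<parallel>e - d\<parallel>\<^sup>2 = \<parallel>d\<parallel>\<^sup>2 - \<parallel>e\<parallel>\<^sup>2 + 2 (e - d) \<bullet> e\<close> and, for the centred coin \<open>i\<close>,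
  \<open>i\<^sup>2 = p (1 - p) + (1 - 2 p) i\<close>.\<close>

lemma residual_bound:
  fixes h v e d z' w :: "'a::euclidean_space"
  assumes p: "0 \<le> p" "p \<le> 1" and \<delta>: "\<delta> > 0" and \<gamma>: "\<gamma> > 0"
    and u: "u = (2 * \<tau>) *\<^sub>R (e - d) + (2 * (of_bool b - p)) *\<^sub>R (z' - w)"
  shows "2 * \<tau> * ((e - d) \<bullet> h) + (of_bool b - p) * ((norm z')\<^sup>2 - (norm w)\<^sup>2) - u \<bullet> v + \<delta> / 2 * (norm u)\<^sup>2
         - 2 * \<tau> * (d \<bullet> (z' - h)) - (norm (z' - h))\<^sup>2 - p * (norm (h - w))\<^sup>2
    \<le> 2 * \<tau> * ((e - d) \<bullet> (h - v + (2 * \<delta> * \<tau>) *\<^sub>R e))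
      + (of_bool b - p) * ((norm z')\<^sup>2 - (norm w)\<^sup>2 - 2 * ((z' - w) \<bullet> v)
          + 4 * \<delta> * \<tau> * ((e - d) \<bullet> (z' - w)) + 2 * \<delta> * (1 - 2 * p) * (norm (z' - w))\<^sup>2)
      + (2 * \<delta> * \<tau>\<^sup>2 + \<tau>\<^sup>2 / \<gamma>) * (norm d)\<^sup>2 + (4 * \<delta> - 1) * p * (norm (h - w))\<^sup>2
      + (4 * \<delta> - (1 - \<gamma>)) * (norm (z' - h))\<^sup>2"
proof -
  define i where "i = of_bool b - p"
  have i2: "i * i = p * (1 - p) + (1 - 2 * p) * i"
    by (cases b) (simp_all add: i_def algebra_simps)
  have uu: "(norm u)\<^sup>2 = 4 * \<tau>\<^sup>2 * ((e - d) \<bullet> (e - d)) + 8 * \<tau> * i * ((e - d) \<bullet> (z' - w)) + 4 * (i * i) * (norm (z' - w))\<^sup>2"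
    unfolding power2_norm_eq_inner u i_def[symmetric]
    by (simp only: inner_add_left inner_add_right inner_scaleR_left inner_scaleR_right inner_commute[of "z' - w" "e - d"])
       (simp add: algebra_simps power2_eq_square)
  have ee: "(e - d) \<bullet> (e - d) = (norm d)\<^sup>2 - (norm e)\<^sup>2 + 2 * ((e - d) \<bullet> e)"
    unfolding power2_norm_eq_inner by (simp add: algebra_simps inner_commute)
  have uv: "u \<bullet> v = 2 * \<tau> * ((e - d) \<bullet> v) + 2 * i * ((z' - w) \<bullet> v)"
    unfolding u i_def by (simp add: inner_add_left)
  have lin: "(e - d) \<bullet> (h - v + (2 * \<delta> * \<tau>) *\<^sub>R e) = (e - d) \<bullet> h - (e - d) \<bullet> v + 2 * \<delta> * \<tau> * ((e - d) \<bullet> e)"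
    by (simp only: inner_add_right inner_diff_right inner_scaleR_right)
  have young: "- 2 * \<tau> * (d \<bullet> (z' - h)) \<le> \<tau>\<^sup>2 / \<gamma> * (norm d)\<^sup>2 + \<gamma> * (norm (z' - h))\<^sup>2"
  proof -
    have "0 \<le> (norm (\<tau> *\<^sub>R d + \<gamma> *\<^sub>R (z' - h)))\<^sup>2 / \<gamma>" using \<gamma> by simp
    also have "(norm (\<tau> *\<^sub>R d + \<gamma> *\<^sub>R (z' - h)))\<^sup>2
        = \<gamma> * (\<tau>\<^sup>2 / \<gamma> * (norm d)\<^sup>2 + 2 * \<tau> * (d \<bullet> (z' - h)) + \<gamma> * (norm (z' - h))\<^sup>2)"
      unfolding power2_norm_eq_inner using \<gamma>
      by (simp only: inner_add_left inner_add_right inner_scaleR_left inner_scaleR_right inner_commute[of "z' - h" d])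
         (simp add: field_simps power2_eq_square)
    finally show ?thesis using \<gamma> by simp
  qed
  have "(norm (z' - w))\<^sup>2 \<le> 2 * (norm (z' - h))\<^sup>2 + 2 * (norm (h - w))\<^sup>2"
  proof -
    have "0 \<le> (norm ((z' - h) - (h - w)))\<^sup>2" by simp
    then show ?thesis unfolding power2_norm_eq_inner by (simp add: algebra_simps inner_commute)
  qed
  then have "p * (1 - p) * (norm (z' - w))\<^sup>2 \<le> p * (1 - p) * (2 * (norm (z' - h))\<^sup>2 + 2 * (norm (h - w))\<^sup>2)"
    using p by (intro mult_left_mono) auto
  also have "\<dots> = p * (1 - p) * (2 * (norm (z' - h))\<^sup>2) + p * (1 - p) * (2 * (norm (h - w))\<^sup>2)"
    by (simp add: algebra_simps)
  also have "\<dots> \<le> 1 * (2 * (norm (z' - h))\<^sup>2) + p * (2 * (norm (h - w))\<^sup>2)"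
    using p by (intro add_mono mult_right_mono) (auto intro: mult_left_le mult_le_one)
  finally have "p * (1 - p) * (norm (z' - w))\<^sup>2 \<le> 2 * (norm (z' - h))\<^sup>2 + 2 * p * (norm (h - w))\<^sup>2" by simp
  then have S: "2 * \<delta> * (p * (1 - p) * (norm (z' - w))\<^sup>2) \<le> 2 * \<delta> * (2 * (norm (z' - h))\<^sup>2 + 2 * p * (norm (h - w))\<^sup>2)"
    using \<delta> by (intro mult_left_mono) auto
  have "0 \<le> 2 * \<delta> * \<tau>\<^sup>2 * (norm e)\<^sup>2" using \<delta> by simp
  with S young show ?thesis
    unfolding i_def[symmetric] uu i2 ee uv lin
    by (simp add: algebra_simps power2_eq_square[of \<tau>])
qed

section \<open>The gap function\<close>

context closed_convex begin

lemma gap_upper: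
  assumes w: "w \<in> D" and b: "\<And>y. y \<in> C \<Longrightarrow> y \<in> D \<Longrightarrow> F y \<bullet> (w - y) + rh w - rh y \<le> b"
  shows "gap h F C w \<le> ereal b"
  unfolding gap_def
proof (rule SUP_least)
  fix y assume y: "y \<in> C"
  show "ereal (F y \<bullet> (w - y)) + h w - h y \<le> ereal b"
  proof (cases "y \<in> D")
    case True
    then show ?thesis using b[OF y True] w by (auto elim!: domE)
  next
    case False
    then show ?thesis using w by (auto elim!: domE simp: outside_dom)
  qed
qed

lemma gap_lower:
  assumes w: "w \<in> D" and y: "y \<in> C" "y \<in> D"
  shows "ereal (F y \<bullet> (w - y) + rh w - rh y) \<le> gap h F C w"
proof -
  have "ereal (F y \<bullet> (w - y)) + h w - h y \<le> gap h F C w"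
    unfolding gap_def using y(1) by (rule SUP_upper)
  then show ?thesis using w y(2) by (auto elim!: domE)
qed

text \<open>An uncountable supremum need not be measurable. This one is: apart from the term \<open>h\<close>, it is
  a supremum of affine functions of the evaluation point and hence lower semicontinuous.\<close>

lemma gap_measurable:
  assumes X [measurable]: "X \<in> borel_measurable M" and dom: "\<And>\<omega>. X \<omega> \<in> D"
  shows "(\<lambda>\<omega>. gap h F C (X \<omega>)) \<in> borel_measurable M"
proof -
  define \<phi> where "\<phi> w = (SUP y\<in>C. ereal (F y \<bullet> (w - y)) - h y)" for w
  have "open {w. a < \<phi> w}" for a
  proof -
    have "{w. a < \<phi> w} = (\<Union>y\<in>C. {w. a < ereal (F y \<bullet> (w - y)) - h y})"
      by (auto simp: \<phi>_def less_SUP_iff)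
    moreover have "open {w. a < ereal (F y \<bullet> (w - y)) - h y}" for y
    proof (cases "y \<in> D")
      case True
      then obtain r where r: "h y = ereal r" by (elim domE)
      show ?thesis unfolding r by (auto intro!: open_Collect_less continuous_intros)
    qed (simp add: outside_dom)
    ultimately show ?thesis by auto
  qed
  then have [measurable]: "\<phi> \<in> borel_measurable borel"
    by (intro borel_measurableI_greater) simp
  have "gap h F C (X \<omega>) = \<phi> (X \<omega>) + h (X \<omega>)" if "C \<noteq> {}" for \<omega>
  proof -
    have "gap h F C (X \<omega>) = (SUP y\<in>C. (ereal (F y \<bullet> (X \<omega> - y)) - h y) + h (X \<omega>))"
      unfolding gap_def
    proof (rule SUP_cong)
      fix y show "ereal (F y \<bullet> (X \<omega> - y)) + h (X \<omega>) - h y = ereal (F y \<bullet> (X \<omega> - y)) - h y + h (X \<omega>)"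
        using dom[of \<omega>] not_MInf[of y] by (cases "h y") (auto elim!: domE)
    qed simp
    also have "\<dots> = \<phi> (X \<omega>) + h (X \<omega>)"
      unfolding \<phi>_def using that by (intro SUP_ereal_add_left) auto
    finally show ?thesis .
  qed
  then show ?thesis
    by (cases "C = {}") (simp_all add: gap_def bot_ereal_def)
qed

end

section \<open>The iterates as a measurable recursion\<close>

text \<open>Borel measurability of \<open>F\<close> on the whole space makes the iterates random variables. A given
  \<open>F\<close> is constrained only on the domain of \<open>g\<close>; \<open>expected_gap_bound\<close> reduces to this setting.\<close>

locale eg_run = vi: stochastic_vi Q g F Fo L + eg_sampling M Q p \<xi> coin
  for Q :: "'s measure" and g :: "'a::euclidean_space \<Rightarrow> ereal" and F Fo L
    and M :: "'w measure" and p \<xi> coin +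
  fixes \<gamma> \<tau> :: real and z0 :: 'a
  assumes F_borel [measurable]: "F \<in> borel_measurable borel"
    and \<gamma>: "0 < \<gamma>" "\<gamma> < 1"
    and \<tau>: "\<tau> = sqrt p / L * \<gamma>"
    and z0: "z0 \<in> effective_dom g"
begin

abbreviation G :: "'a \<Rightarrow> real" where "G z \<equiv> real_of_ereal (g z)"

lemma \<tau>_pos: "\<tau> > 0"
  using \<gamma> p_pos vi.L_pos by (simp add: \<tau>)

lemma \<tau>_L: "\<tau>\<^sup>2 * L\<^sup>2 = p * \<gamma>\<^sup>2"
  using p_pos vi.L_pos by (simp add: \<tau> power_mult_distrib power_divide)

text \<open>The step of the auxiliary sequence, as large as the negative terms of an iteration permit:
  after the cross term of the proximal steps a fraction \<open>1 - \<gamma>\<close> of them is left, and the auxiliary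
  sequence consumes at most \<open>6 \<delta>\<close>.\<close>

definition \<delta> :: real where "\<delta> = (1 - \<gamma>) / 6"

lemma \<delta>_pos: "\<delta> > 0" using \<gamma> by (simp add: \<delta>_def)

sublocale gc: closed_convex g
  using vi.proper vi.convex vi.lsc by unfold_locales

definition P :: "'a \<Rightarrow> 'a" where "P = prox (\<lambda>y. ereal \<tau> * g y)"

lemma P_in_dom: "P x \<in> vi.dom_g"
  and P_variational: "y \<in> vi.dom_g \<Longrightarrow> 0 \<le> (P x - x) \<bullet> (y - P x) + \<tau> * G y - \<tau> * G (P x)"
  and P_nonexpansive: "norm (P x - P y) \<le> norm (x - y)"
  and P_borel [measurable]: "P \<in> borel_measurable borel"
proof -
  interpret t: closed_convex "\<lambda>y. ereal \<tau> * g y"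
    by (rule closed_convex_scale[OF gc.closed_convex_axioms \<tau>_pos])
  note dom = closed_convex_scale(2)[OF gc.closed_convex_axioms \<tau>_pos]
  show "P x \<in> vi.dom_g" unfolding P_def using t.prox_in_dom by (simp add: dom)
  show "0 \<le> (P x - x) \<bullet> (y - P x) + \<tau> * G y - \<tau> * G (P x)" if "y \<in> vi.dom_g"
    unfolding P_def using t.prox_variational[of y x] that by (simp add: dom)
  show "norm (P x - P y) \<le> norm (x - y)" unfolding P_def by (rule t.prox_nonexpansive)
  show "P \<in> borel_measurable borel" unfolding P_def by (rule t.prox_borel)
qed

definition half :: "'a \<Rightarrow> 'a \<Rightarrow> 'a" where
  "half z w = P (eg_bar (1 - p) z w - \<tau> *\<^sub>R F w)"

definition upd :: "'s \<Rightarrow> 'a \<Rightarrow> 'a \<Rightarrow> 'a" where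
  "upd x z w = P (eg_bar (1 - p) z w - \<tau> *\<^sub>R (F w + (Fo x (half z w) - Fo x w)))"

definition noise_map :: "'s \<Rightarrow> bool \<Rightarrow> 'a \<Rightarrow> 'a \<Rightarrow> 'a" where
  "noise_map x b z w = (2 * \<tau>) *\<^sub>R (F (half z w) - F w - (Fo x (half z w) - Fo x w))
     + (2 * (of_bool b - p)) *\<^sub>R (upd x z w - w)"

definition transition :: "('a \<times> 'a \<times> 'a) \<times> 's \<times> bool \<Rightarrow> 'a \<times> 'a \<times> 'a" where
  "transition = (\<lambda>((z, w, v), (x, b)).
     (upd x z w, if b then upd x z w else w, v - \<delta> *\<^sub>R noise_map x b z w))"

text \<open>The state is \<open>(z_k, w_k, v_k)\<close>. Carrying the auxiliary point \<open>v_k\<close> in the state makes it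
  independent of the draws of iteration \<open>k\<close> for the same reason as the iterates.\<close>

primrec st :: "nat \<Rightarrow> 'w \<Rightarrow> 'a \<times> 'a \<times> 'a" where
  "st 0 \<omega> = (z0, z0, z0)"
| "st (Suc k) \<omega> = transition (st k \<omega>, (\<xi> k \<omega>, coin k \<omega>))"

definition Z :: "nat \<Rightarrow> 'w \<Rightarrow> 'a" where "Z k \<omega> = fst (st k \<omega>)"
definition W :: "nat \<Rightarrow> 'w \<Rightarrow> 'a" where "W k \<omega> = fst (snd (st k \<omega>))"
definition V :: "nat \<Rightarrow> 'w \<Rightarrow> 'a" where "V k \<omega> = snd (snd (st k \<omega>))"
definition H :: "nat \<Rightarrow> 'w \<Rightarrow> 'a" where "H k \<omega> = half (Z k \<omega>) (W k \<omega>)"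
definition op_diff :: "nat \<Rightarrow> 'w \<Rightarrow> 'a" where "op_diff k \<omega> = F (H k \<omega>) - F (W k \<omega>)"
definition oracle_diff :: "nat \<Rightarrow> 'w \<Rightarrow> 'a" where "oracle_diff k \<omega> = Fo (\<xi> k \<omega>) (H k \<omega>) - Fo (\<xi> k \<omega>) (W k \<omega>)"
definition noise :: "nat \<Rightarrow> 'w \<Rightarrow> 'a" where
  "noise k \<omega> = (2 * \<tau>) *\<^sub>R (op_diff k \<omega> - oracle_diff k \<omega>) + (2 * (of_bool (coin k \<omega>) - p)) *\<^sub>R (Z (Suc k) \<omega> - W k \<omega>)"

lemma st_eq: "st k \<omega> = (Z k \<omega>, W k \<omega>, V k \<omega>)"
  by (simp add: Z_def W_def V_def)

lemma init [simp]: "Z 0 \<omega> = z0" "W 0 \<omega> = z0" "V 0 \<omega> = z0"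
  by (simp_all add: Z_def W_def V_def)

lemma Z_Suc_upd: "Z (Suc k) \<omega> = upd (\<xi> k \<omega>) (Z k \<omega>) (W k \<omega>)"
  by (simp add: Z_def W_def transition_def case_prod_unfold)

lemma Z_Suc: "Z (Suc k) \<omega> = P (eg_bar (1 - p) (Z k \<omega>) (W k \<omega>) - \<tau> *\<^sub>R (F (W k \<omega>) + oracle_diff k \<omega>))"
  by (simp add: Z_Suc_upd upd_def oracle_diff_def H_def)

lemma W_Suc: "W (Suc k) \<omega> = (if coin k \<omega> then Z (Suc k) \<omega> else W k \<omega>)"
  by (simp add: Z_def W_def transition_def case_prod_unfold)

lemma V_Suc: "V (Suc k) \<omega> = V k \<omega> - \<delta> *\<^sub>R noise k \<omega>"
proof -
  have "V (Suc k) \<omega> = V k \<omega> - \<delta> *\<^sub>R noise_map (\<xi> k \<omega>) (coin k \<omega>) (Z k \<omega>) (W k \<omega>)"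
    by (simp add: Z_def W_def V_def transition_def case_prod_unfold)
  then show ?thesis by (simp add: noise_map_def noise_def op_diff_def oracle_diff_def H_def Z_Suc_upd)
qed

lemma H_eq: "H k \<omega> = P (eg_bar (1 - p) (Z k \<omega>) (W k \<omega>) - \<tau> *\<^sub>R F (W k \<omega>))"
  by (simp add: H_def half_def)

lemma in_dom: "H k \<omega> \<in> vi.dom_g" "Z k \<omega> \<in> vi.dom_g" "W k \<omega> \<in> vi.dom_g"
proof -
  show H: "H k \<omega> \<in> vi.dom_g" for k by (simp add: H_def half_def P_in_dom)
  show Z: "Z k \<omega> \<in> vi.dom_g" for k by (cases k) (simp_all add: z0 Z_Suc P_in_dom)
  show "W k \<omega> \<in> vi.dom_g" by (induction k) (use Z in \<open>simp_all add: z0 W_Suc\<close>)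
qed

lemma eg_state_eq:
  "eg_state g F Fo \<tau> (1 - p) z0 (\<lambda>k. \<xi> k \<omega>) (\<lambda>k. coin k \<omega>) k = (Z k \<omega>, W k \<omega>)"
proof (induction k)
  case (Suc k)
  have "eg_update g F Fo \<tau> (1 - p) (\<xi> k \<omega>) (Z k \<omega>) (W k \<omega>) = Z (Suc k) \<omega>"
    by (simp add: eg_update_def eg_extrapolate_def Z_Suc oracle_diff_def H_eq P_def add_diff_eq)
  with Suc show ?case by (simp add: W_Suc Let_def)
qed simp

lemma eg_average_eq:
  "eg_average g F Fo \<tau> (1 - p) z0 (\<lambda>k. \<xi> k \<omega>) (\<lambda>k. coin k \<omega>) K = (1 / real K) *\<^sub>R (\<Sum>k<K. H k \<omega>)"
  by (simp add: eg_average_def eg_half_def eg_state_eq eg_extrapolate_def H_eq P_def)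

subsection \<open>Measurability\<close>

abbreviation state_space :: "('a \<times> 'a \<times> 'a) measure" where
  "state_space \<equiv> borel \<Otimes>\<^sub>M (borel \<Otimes>\<^sub>M borel)"

lemma half_measurable [measurable (raw)]:
  assumes [measurable]: "f \<in> borel_measurable N" "h \<in> borel_measurable N"
  shows "(\<lambda>x. half (f x) (h x)) \<in> borel_measurable N"
  unfolding half_def eg_bar_def by measurable

lemma oracle_measurable_raw [measurable (raw)]:
  "f \<in> measurable N Q \<Longrightarrow> h \<in> borel_measurable N \<Longrightarrow> (\<lambda>x. Fo (f x) (h x)) \<in> borel_measurable N"
  by (rule vi.oracle_compose)

lemma upd_measurable [measurable (raw)]:
  assumes [measurable]: "i \<in> measurable N Q" "f \<in> borel_measurable N" "h \<in> borel_measurable N"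
  shows "(\<lambda>x. upd (i x) (f x) (h x)) \<in> borel_measurable N"
  unfolding upd_def eg_bar_def by measurable

lemma transition_measurable: "transition \<in> measurable (state_space \<Otimes>\<^sub>M step_space) state_space"
  unfolding transition_def noise_map_def of_bool_def case_prod_unfold by measurable

sublocale run: sampled_recursion M Q p \<xi> coin st state_space transition "(z0, z0, z0)"
  by unfold_locales (auto simp: transition_measurable space_pair_measure)

lemma st_measurable [measurable]: "st k \<in> measurable M state_space"
  by (rule run.state_measurable)

lemma iterates_measurable [measurable]:
  "Z k \<in> borel_measurable M" "W k \<in> borel_measurable M" "V k \<in> borel_measurable M"
  "H k \<in> borel_measurable M" "op_diff k \<in> borel_measurable M" "oracle_diff k \<in> borel_measurable M"
  "noise k \<in> borel_measurable M"
proof -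
  show Z [measurable]: "Z k \<in> borel_measurable M" for k unfolding Z_def by measurable
  show [measurable]: "W k \<in> borel_measurable M" unfolding W_def by measurable
  show "V k \<in> borel_measurable M" unfolding V_def by measurable
  show [measurable]: "H k \<in> borel_measurable M" unfolding H_def by measurable
  show [measurable]: "op_diff k \<in> borel_measurable M" unfolding op_diff_def by measurable
  show [measurable]: "oracle_diff k \<in> borel_measurable M" unfolding oracle_diff_def by measurable
  show "noise k \<in> borel_measurable M" unfolding noise_def of_bool_def by measurable
qed

subsection \<open>Square integrability\<close>

text \<open>Nonexpansiveness gives \<open>P\<close> linear growth.\<close>

lemma sq_P:
  assumes X: "sq_integrable M X" shows "sq_integrable M (\<lambda>\<omega>. P (X \<omega>))"
proof (rule sq_integrable_bound)
  show "sq_integrable M (\<lambda>\<omega>. norm (P 0) + norm (X \<omega>))"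
    by (intro sq_integrable_add sq_integrable_const sq_integrable_norm X finite_measure_axioms)
  show "(\<lambda>\<omega>. P (X \<omega>)) \<in> borel_measurable M"
    using sq_integrable_measurable[OF X] by measurable
  show "norm (P (X \<omega>)) \<le> norm (norm (P 0) + norm (X \<omega>))" for \<omega>
    using P_nonexpansive[of "X \<omega>" 0] norm_triangle_ineq2[of "P (X \<omega>)" "P 0"] by simp
qed

lemma sq_F:
  assumes X: "sq_integrable M X" and dom: "\<And>\<omega>. X \<omega> \<in> vi.dom_g"
  shows "sq_integrable M (\<lambda>\<omega>. F (X \<omega>))"
proof (rule sq_integrable_bound)
  show "sq_integrable M (\<lambda>\<omega>. norm (F z0) + L *\<^sub>R norm (X \<omega> - z0))"
    by (intro sq_integrable_add sq_integrable_const sq_integrable_scaleR sq_integrable_norm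
        sq_integrable_minus X finite_measure_axioms)
  show "(\<lambda>\<omega>. F (X \<omega>)) \<in> borel_measurable M"
    using sq_integrable_measurable[OF X] by measurable
  show "norm (F (X \<omega>)) \<le> norm (norm (F z0) + L *\<^sub>R norm (X \<omega> - z0))" for \<omega>
    using vi.F_lipschitz[OF dom z0, of \<omega>] norm_triangle_ineq2[of "F (X \<omega>)" "F z0"] vi.L_pos by simp
qed

lemma sq_bar:
  assumes "sq_integrable M (Z k)" "sq_integrable M (W k)" "sq_integrable M Y"
  shows "sq_integrable M (\<lambda>\<omega>. eg_bar (1 - p) (Z k \<omega>) (W k \<omega>) - \<tau> *\<^sub>R Y \<omega>)"
  unfolding eg_bar_def
  by (intro sq_integrable_add sq_integrable_minus sq_integrable_scaleR assms)

text \<open>At a frozen state this is the mean Lipschitz bound. The version with values in \<open>[0,\<infinity>]\<close>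
  presupposes no integrability, so it can be used to establish it.\<close>

lemma nn_oracle_diff_le:
  "(\<integral>\<^sup>+\<omega>. ennreal ((norm (oracle_diff k \<omega>))\<^sup>2) \<partial>M) \<le> (\<integral>\<^sup>+\<omega>. ennreal (L\<^sup>2 * (norm (H k \<omega> - W k \<omega>))\<^sup>2) \<partial>M)"
proof -
  define f :: "('a \<times> 'a \<times> 'a) \<times> 's \<Rightarrow> ennreal" where
    "f = (\<lambda>((z, w, v), x). ennreal ((norm (Fo x (half z w) - Fo x w))\<^sup>2))"
  have "f \<in> borel_measurable (state_space \<Otimes>\<^sub>M Q)" unfolding f_def case_prod_unfold by measurable
  from run.nn_integral_fresh_index[OF this, of k]
  have "(\<integral>\<^sup>+\<omega>. ennreal ((norm (oracle_diff k \<omega>))\<^sup>2) \<partial>M)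
      = (\<integral>\<^sup>+\<omega>. (\<integral>\<^sup>+x. ennreal ((norm (Fo x (H k \<omega>) - Fo x (W k \<omega>)))\<^sup>2) \<partial>Q) \<partial>M)"
    by (simp add: f_def st_eq oracle_diff_def H_def)
  also have "\<dots> \<le> (\<integral>\<^sup>+\<omega>. ennreal (L\<^sup>2 * (norm (H k \<omega> - W k \<omega>))\<^sup>2) \<partial>M)"
    by (intro nn_integral_mono vi.lipschitz_in_mean)
  finally show ?thesis .
qed

lemma sq_half_and_oracle_diff:
  assumes Z: "sq_integrable M (Z k)" and W: "sq_integrable M (W k)"
  shows "sq_integrable M (H k)" "sq_integrable M (oracle_diff k)"
proof -
  have "sq_integrable M (\<lambda>\<omega>. H k \<omega>)"
    unfolding H_eq by (intro sq_P sq_bar sq_F Z W in_dom)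
  then show H: "sq_integrable M (H k)" by simp
  have "integrable M (\<lambda>\<omega>. L\<^sup>2 * (norm (H k \<omega> - W k \<omega>))\<^sup>2)"
    using sq_integrable_norm_sq[OF sq_integrable_minus[OF H W]] by simp
  then have "(\<integral>\<^sup>+\<omega>. ennreal (L\<^sup>2 * (norm (H k \<omega> - W k \<omega>))\<^sup>2) \<partial>M) < \<infinity>"
    by (subst nn_integral_eq_integral) auto
  then show "sq_integrable M (oracle_diff k)"
    by (intro sq_integrable_nn_integral le_less_trans[OF nn_oracle_diff_le]) auto
qed

lemma sq_pair: "sq_integrable M (Z k) \<and> sq_integrable M (W k)"
proof (induction k)
  case 0
  have "Z 0 = (\<lambda>_. z0)" "W 0 = (\<lambda>_. z0)" by (auto simp: fun_eq_iff)
  then show ?case using sq_integrable_const[OF finite_measure_axioms] by metis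
next
  case (Suc k)
  note HB = sq_half_and_oracle_diff[of k]
  have "sq_integrable M (\<lambda>\<omega>. Z (Suc k) \<omega>)"
    unfolding Z_Suc using Suc HB by (intro sq_P sq_bar sq_integrable_add sq_F in_dom) auto
  then have Z: "sq_integrable M (Z (Suc k))" by simp
  have "sq_integrable M (W (Suc k))"
  proof (rule sq_integrable_bound)
    show "sq_integrable M (\<lambda>\<omega>. norm (Z (Suc k) \<omega>) + norm (W k \<omega>))"
      using Z Suc by (intro sq_integrable_add sq_integrable_norm) auto
  qed (auto simp: W_Suc)
  with Z show ?case by simp
qed

lemma sq_Z: "sq_integrable M (Z k)" and sq_W: "sq_integrable M (W k)"
  and sq_H: "sq_integrable M (H k)" and sq_oracle_diff: "sq_integrable M (oracle_diff k)"
  using sq_pair[of k] sq_half_and_oracle_diff[of k] by auto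

lemma sq_op_diff: "sq_integrable M (op_diff k)"
proof -
  have "sq_integrable M (\<lambda>\<omega>. op_diff k \<omega>)"
    unfolding op_diff_def by (intro sq_integrable_minus sq_F sq_H sq_W in_dom)
  then show ?thesis by simp
qed

lemma coin_bound: "\<bar>of_bool b - p\<bar> \<le> 1"
  using p_pos p_le_1 by (cases b) auto

lemma sq_noise: "sq_integrable M (noise k)"
proof -
  have S: "sq_integrable M (\<lambda>\<omega>. Z (Suc k) \<omega> - W k \<omega>)"
    by (intro sq_integrable_minus sq_Z sq_W)
  have "sq_integrable M (\<lambda>\<omega>. (of_bool (coin k \<omega>) - p) *\<^sub>R (Z (Suc k) \<omega> - W k \<omega>))"
  proof (rule sq_integrable_bound[OF S])
    show "(\<lambda>\<omega>. (of_bool (coin k \<omega>) - p) *\<^sub>R (Z (Suc k) \<omega> - W k \<omega>)) \<in> borel_measurable M"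
      unfolding of_bool_def by measurable
    show "norm ((of_bool (coin k \<omega>) - p) *\<^sub>R (Z (Suc k) \<omega> - W k \<omega>)) \<le> norm (Z (Suc k) \<omega> - W k \<omega>)" for \<omega>
      using coin_bound by (simp add: mult_left_le_one_le)
  qed
  from sq_integrable_scaleR[OF this, of 2]
  have "sq_integrable M (\<lambda>\<omega>. noise k \<omega>)"
    unfolding noise_def by (intro sq_integrable_add sq_integrable_scaleR sq_integrable_minus sq_op_diff sq_oracle_diff) simp
  then show ?thesis by simp
qed

lemma sq_V: "sq_integrable M (V k)"
proof (induction k)
  case 0
  have "V 0 = (\<lambda>_. z0)" by (auto simp: fun_eq_iff)
  then show ?case using sq_integrable_const[OF finite_measure_axioms] by metis
next
  case (Suc k)
  have "sq_integrable M (\<lambda>\<omega>. V (Suc k) \<omega>)"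
    unfolding V_Suc by (intro sq_integrable_minus sq_integrable_scaleR Suc sq_noise)
  then show ?case by simp
qed

end

section \<open>Expected decrease of the potential\<close>

context eg_run begin

definition \<Psi> :: "nat \<Rightarrow> 'w \<Rightarrow> 'a \<Rightarrow> real" where
  "\<Psi> k \<omega> y = (1 - p) * (norm (Z k \<omega> - y))\<^sup>2 + (norm (W k \<omega> - y))\<^sup>2 + (norm (V k \<omega> - y))\<^sup>2 / (2 * \<delta>)"

text \<open>The terms of \<open>potential_inequality\<close> that are free of the comparison point.\<close>

definition residual :: "nat \<Rightarrow> 'w \<Rightarrow> real" where
  "residual k \<omega> = 2 * \<tau> * ((op_diff k \<omega> - oracle_diff k \<omega>) \<bullet> H k \<omega>)
     + (of_bool (coin k \<omega>) - p) * ((norm (Z (Suc k) \<omega>))\<^sup>2 - (norm (W k \<omega>))\<^sup>2)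
     - noise k \<omega> \<bullet> V k \<omega> + \<delta> / 2 * (norm (noise k \<omega>))\<^sup>2
     - 2 * \<tau> * (oracle_diff k \<omega> \<bullet> (Z (Suc k) \<omega> - H k \<omega>))
     - (norm (Z (Suc k) \<omega> - H k \<omega>))\<^sup>2 - p * (norm (H k \<omega> - W k \<omega>))\<^sup>2"

lemma potential_step:
  assumes y: "y \<in> vi.dom_g"
  shows "2 * \<tau> * (F y \<bullet> (H k \<omega> - y) + G (H k \<omega>) - G y) + \<Psi> (Suc k) \<omega> y \<le> \<Psi> k \<omega> y + residual k \<omega>"
proof -
  have u: "noise k \<omega> = (2 * \<tau>) *\<^sub>R (F (H k \<omega>) - F (W k \<omega>) - oracle_diff k \<omega>)
      + (2 * (of_bool (coin k \<omega>) - p)) *\<^sub>R (Z (Suc k) \<omega> - W k \<omega>)"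
    by (simp add: noise_def op_diff_def)
  have extrapolate: "0 \<le> (H k \<omega> - (eg_bar (1 - p) (Z k \<omega>) (W k \<omega>) - \<tau> *\<^sub>R F (W k \<omega>))) \<bullet> (Z (Suc k) \<omega> - H k \<omega>)
      + \<tau> * G (Z (Suc k) \<omega>) - \<tau> * G (H k \<omega>)"
    using P_variational[OF in_dom(2)] unfolding H_eq by blast
  have update: "0 \<le> (Z (Suc k) \<omega> - (eg_bar (1 - p) (Z k \<omega>) (W k \<omega>) - \<tau> *\<^sub>R (F (W k \<omega>) + oracle_diff k \<omega>))) \<bullet> (y - Z (Suc k) \<omega>)
      + \<tau> * G y - \<tau> * G (Z (Suc k) \<omega>)"
    using P_variational[OF y] unfolding Z_Suc by blast
  have "2 * \<tau> * (F (H k \<omega>) \<bullet> (H k \<omega> - y) + G (H k \<omega>) - G y) + \<Psi> (Suc k) \<omega> y \<le> \<Psi> k \<omega> y + residual k \<omega>"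
    unfolding \<Psi>_def residual_def W_Suc V_Suc op_diff_def
    by (rule potential_inequality[OF extrapolate update p_le_1 \<delta>_pos u])
  moreover have "F y \<bullet> (H k \<omega> - y) \<le> F (H k \<omega>) \<bullet> (H k \<omega> - y)"
    using vi.monotone[OF in_dom(1)[of k \<omega>] y] by (simp add: inner_diff_left)
  then have "2 * \<tau> * (F y \<bullet> (H k \<omega> - y) + G (H k \<omega>) - G y)
      \<le> 2 * \<tau> * (F (H k \<omega>) \<bullet> (H k \<omega> - y) + G (H k \<omega>) - G y)"
    using \<tau>_pos by (intro mult_left_mono) auto
  ultimately show ?thesis by linarith
qed

text \<open>The oracle error is a martingale difference: it is orthogonal to every function of the
  current state.\<close>

lemma oracle_error_orthogonal:
  assumes r [measurable]: "r \<in> borel_measurable state_space"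
    and sq: "sq_integrable M (\<lambda>\<omega>. r (st k \<omega>))"
  shows "expectation (\<lambda>\<omega>. (op_diff k \<omega> - oracle_diff k \<omega>) \<bullet> r (st k \<omega>)) = 0"
proof -
  define f :: "('a \<times> 'a \<times> 'a) \<times> 's \<Rightarrow> real" where
    "f = (\<lambda>(s, x). (F (half (fst s) (fst (snd s))) - F (fst (snd s))
        - (Fo x (half (fst s) (fst (snd s))) - Fo x (fst (snd s)))) \<bullet> r s)"
  have f: "f \<in> borel_measurable (state_space \<Otimes>\<^sub>M Q)" unfolding f_def case_prod_unfold by measurable
  have AB: "f (st k \<omega>, \<xi> k \<omega>) = (op_diff k \<omega> - oracle_diff k \<omega>) \<bullet> r (st k \<omega>)" for \<omega>
    by (simp add: f_def op_diff_def oracle_diff_def H_def Z_def W_def)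
  have int: "integrable M (\<lambda>\<omega>. f (st k \<omega>, \<xi> k \<omega>))"
    unfolding AB by (intro integrable_inner_sq_integrable sq sq_integrable_minus sq_op_diff sq_oracle_diff)
  have "(\<integral>x. f (st k \<omega>, x) \<partial>Q) = 0" for \<omega>
  proof -
    have "integrable Q (\<lambda>x. Fo x (H k \<omega>) - Fo x (W k \<omega>))"
      by (rule vi.integrable_sq_integrable) (rule vi.oracle_difference)
    then have "(\<integral>x. (op_diff k \<omega> - (Fo x (H k \<omega>) - Fo x (W k \<omega>))) \<bullet> r (st k \<omega>) \<partial>Q) = 0"
      by (simp add: vi.mean_oracle_difference[OF in_dom(1,3)] vi.prob_space op_diff_def)
    then show ?thesis by (simp add: f_def op_diff_def H_def Z_def W_def)
  qed
  with run.expectation_fresh_index[OF f int] show ?thesis by (simp add: AB)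
qed

lemma second_moment_oracle_diff:
  "expectation (\<lambda>\<omega>. (norm (oracle_diff k \<omega>))\<^sup>2) \<le> L\<^sup>2 * expectation (\<lambda>\<omega>. (norm (H k \<omega> - W k \<omega>))\<^sup>2)"
proof -
  note HW = sq_integrable_norm_sq[OF sq_integrable_minus[OF sq_H sq_W], of k k]
  have "ennreal (expectation (\<lambda>\<omega>. (norm (oracle_diff k \<omega>))\<^sup>2))
      \<le> ennreal (expectation (\<lambda>\<omega>. L\<^sup>2 * (norm (H k \<omega> - W k \<omega>))\<^sup>2))"
    using nn_oracle_diff_le[of k] sq_integrable_norm_sq[OF sq_oracle_diff[of k]] HW
    by (simp add: nn_integral_eq_integral)
  then have "expectation (\<lambda>\<omega>. (norm (oracle_diff k \<omega>))\<^sup>2) \<le> expectation (\<lambda>\<omega>. L\<^sup>2 * (norm (H k \<omega> - W k \<omega>))\<^sup>2)"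
    by (subst (asm) ennreal_le_iff) auto
  then show ?thesis by simp
qed

lemma integrable_coin_times:
  assumes "integrable M (f :: 'w \<Rightarrow> real)"
  shows "integrable M (\<lambda>\<omega>. (of_bool (coin k \<omega>) - p) * f \<omega>)"
proof (rule Bochner_Integration.integrable_bound[OF assms])
  have [measurable]: "f \<in> borel_measurable M" using assms by simp
  show "(\<lambda>\<omega>. (of_bool (coin k \<omega>) - p) * f \<omega>) \<in> borel_measurable M"
    unfolding of_bool_def by measurable
  show "AE \<omega> in M. norm ((of_bool (coin k \<omega>) - p) * f \<omega>) \<le> norm (f \<omega>)"
    using coin_bound by (auto simp: abs_mult mult_left_le_one_le)
qed

lemma residual_integrable: "integrable M (residual k)"
proof -
  note sq = sq_Z sq_W sq_H sq_op_diff sq_oracle_diff sq_noise sq_V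
  have "integrable M (\<lambda>\<omega>. residual k \<omega>)"
    unfolding residual_def
    by (intro Bochner_Integration.integrable_add Bochner_Integration.integrable_diff integrable_mult_right integrable_coin_times
        integrable_inner_sq_integrable sq_integrable_norm_sq sq_integrable_minus sq)
  then show ?thesis by simp
qed

text \<open>After \<open>residual_bound\<close>, the first two terms have mean zero. The three squares compete with the
  negative terms: the oracle difference contributes \<open>2 \<delta> \<gamma>\<^sup>2 + \<gamma>\<close> times
  \<open>p E \<parallel>z_{k+1/2} - w_k\<parallel>\<^sup>2\<close> by the mean Lipschitz bound and \<open>\<tau>\<^sup>2 L\<^sup>2 = p \<gamma>\<^sup>2\<close>, so the coefficient
  there is at most \<open>6 \<delta> - (1 - \<gamma>) = 0\<close>.\<close>

lemma residual_expectation: "expectation (residual k) \<le> 0"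
proof -
  note sq = sq_Z sq_W sq_H sq_op_diff sq_oracle_diff sq_noise sq_V
  let ?S = "\<lambda>\<omega>. Z (Suc k) \<omega> - W k \<omega>"
  \<comment> \<open>The function of the state that \<open>residual_bound\<close> pairs with the oracle error, and the factor
     of the centred coin.\<close>
  define r :: "'a \<times> 'a \<times> 'a \<Rightarrow> 'a" where
    "r = (\<lambda>s. half (fst s) (fst (snd s)) - snd (snd s)
        + (2 * \<delta> * \<tau>) *\<^sub>R (F (half (fst s) (fst (snd s))) - F (fst (snd s))))"
  have r: "r \<in> borel_measurable state_space" unfolding r_def by measurable
  have r_st: "r (st k \<omega>) = H k \<omega> - V k \<omega> + (2 * \<delta> * \<tau>) *\<^sub>R op_diff k \<omega>" for \<omega>
    by (simp add: r_def H_def op_diff_def Z_def W_def V_def)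
  have sq_r: "sq_integrable M (\<lambda>\<omega>. r (st k \<omega>))"
    unfolding r_st by (intro sq_integrable_add sq_integrable_minus sq_integrable_scaleR sq)
  define Y where "Y \<omega> = (norm (Z (Suc k) \<omega>))\<^sup>2 - (norm (W k \<omega>))\<^sup>2 - 2 * (?S \<omega> \<bullet> V k \<omega>)
          + 4 * \<delta> * \<tau> * ((op_diff k \<omega> - oracle_diff k \<omega>) \<bullet> ?S \<omega>) + 2 * \<delta> * (1 - 2 * p) * (norm (?S \<omega>))\<^sup>2" for \<omega>
  have Y_int: "integrable M Y"
  proof -
    have "integrable M (\<lambda>\<omega>. Y \<omega>)" unfolding Y_def
      by (intro Bochner_Integration.integrable_add Bochner_Integration.integrable_diff integrable_mult_right
        integrable_inner_sq_integrable sq_integrable_norm_sq sq_integrable_minus sq)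
    then show ?thesis by simp
  qed
  have coin: "expectation (\<lambda>\<omega>. (of_bool (coin k \<omega>) - p) * Y \<omega>) = 0"
  proof -
    define f :: "('a \<times> 'a \<times> 'a) \<times> 's \<Rightarrow> real" where
      "f = (\<lambda>((z, w, v), x). (norm (upd x z w))\<^sup>2 - (norm w)\<^sup>2 - 2 * ((upd x z w - w) \<bullet> v)
          + 4 * \<delta> * \<tau> * ((F (half z w) - F w - (Fo x (half z w) - Fo x w)) \<bullet> (upd x z w - w))
          + 2 * \<delta> * (1 - 2 * p) * (norm (upd x z w - w))\<^sup>2)"
    have f: "f \<in> borel_measurable (state_space \<Otimes>\<^sub>M Q)" unfolding f_def case_prod_unfold by measurable
    have fY: "f (st k \<omega>, \<xi> k \<omega>) = Y \<omega>" for \<omega>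
      by (simp add: f_def Y_def st_eq op_diff_def oracle_diff_def H_def Z_Suc_upd)
    have "integrable M (\<lambda>\<omega>. f (st k \<omega>, \<xi> k \<omega>))" unfolding fY by (rule Y_int)
    from run.expectation_fresh_coin[OF f this] show ?thesis by (simp add: fY)
  qed
  define EA where "EA = expectation (\<lambda>\<omega>. (norm (H k \<omega> - W k \<omega>))\<^sup>2)"
  define EB where "EB = expectation (\<lambda>\<omega>. (norm (Z (Suc k) \<omega> - H k \<omega>))\<^sup>2)"
  define ED where "ED = expectation (\<lambda>\<omega>. (norm (oracle_diff k \<omega>))\<^sup>2)"
  have pos: "0 \<le> EA" "0 \<le> EB" by (auto simp: EA_def EB_def)
  let ?c = "2 * \<delta> * \<tau>\<^sup>2 + \<tau>\<^sup>2 / \<gamma>"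
  have i1: "integrable M (\<lambda>\<omega>. (op_diff k \<omega> - oracle_diff k \<omega>) \<bullet> r (st k \<omega>))"
    by (intro integrable_inner_sq_integrable sq_integrable_minus sq sq_r)
  have i2: "integrable M (\<lambda>\<omega>. (of_bool (coin k \<omega>) - p) * Y \<omega>)"
    by (rule integrable_coin_times[OF Y_int])
  have i3: "integrable M (\<lambda>\<omega>. (norm (oracle_diff k \<omega>))\<^sup>2)" "integrable M (\<lambda>\<omega>. (norm (H k \<omega> - W k \<omega>))\<^sup>2)"
    "integrable M (\<lambda>\<omega>. (norm (Z (Suc k) \<omega> - H k \<omega>))\<^sup>2)"
    by (intro sq_integrable_norm_sq sq_integrable_minus sq)+
  let ?bound = "\<lambda>\<omega>. 2 * \<tau> * ((op_diff k \<omega> - oracle_diff k \<omega>) \<bullet> r (st k \<omega>)) + (of_bool (coin k \<omega>) - p) * Y \<omega>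
      + ?c * (norm (oracle_diff k \<omega>))\<^sup>2 + (4 * \<delta> - 1) * p * (norm (H k \<omega> - W k \<omega>))\<^sup>2
      + (4 * \<delta> - (1 - \<gamma>)) * (norm (Z (Suc k) \<omega> - H k \<omega>))\<^sup>2"
  have "expectation (residual k) \<le> expectation ?bound"
  proof (rule integral_mono)
    show "integrable M ?bound"
      by (intro Bochner_Integration.integrable_add integrable_mult_right i1 i2 i3)
    show "residual k \<omega> \<le> ?bound \<omega>" for \<omega>
      unfolding residual_def Y_def r_st
      by (rule residual_bound) (use p_pos p_le_1 \<delta>_pos \<gamma> in \<open>auto simp: noise_def\<close>)
  qed (rule residual_integrable)
  also have "\<dots> = ?c * ED + (4 * \<delta> - 1) * p * EA + (4 * \<delta> - (1 - \<gamma>)) * EB"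
    using i1 i2 i3 coin oracle_error_orthogonal[OF r sq_r]
    by (simp add: EA_def EB_def ED_def)
  also have "\<dots> \<le> 0"
  proof -
    have "?c * ED \<le> ?c * (L\<^sup>2 * EA)"
      using second_moment_oracle_diff[of k] \<delta>_pos \<gamma> unfolding ED_def EA_def by (intro mult_left_mono) auto
    also have "\<dots> = (2 * \<delta> + 1 / \<gamma>) * (\<tau>\<^sup>2 * L\<^sup>2) * EA" by (simp add: algebra_simps)
    also have "\<dots> = (2 * \<delta> * \<gamma>\<^sup>2 + \<gamma>) * (p * EA)"
      unfolding \<tau>_L using \<gamma> by (simp add: field_simps power2_eq_square)
    also have "\<dots> \<le> (2 * \<delta> + \<gamma>) * (p * EA)"
      using \<delta>_pos \<gamma> p_pos pos by (intro mult_right_mono) (auto simp: power_le_one)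
    finally have "?c * ED + (4 * \<delta> - 1) * p * EA \<le> (6 * \<delta> - (1 - \<gamma>)) * (p * EA)"
      by (simp add: algebra_simps)
    moreover have "(4 * \<delta> - (1 - \<gamma>)) * EB \<le> 0"
      using \<gamma> pos by (intro mult_nonpos_nonneg) (auto simp: \<delta>_def)
    moreover have "6 * \<delta> - (1 - \<gamma>) = 0" by (simp add: \<delta>_def)
    ultimately show ?thesis by simp
  qed
  finally show ?thesis .
qed

text \<open>Telescope the potential and discard its final value; initially all three squared distances
  equal \<open>\<parallel>z0 - y\<parallel>\<^sup>2\<close>, with weights \<open>1 - p\<close>, \<open>1\<close> and \<open>1 / (2 \<delta>) = 3 / (1 - \<gamma>)\<close>.\<close>

lemma gap_sum_bound:
  assumes y: "y \<in> vi.dom_g" and K: "K \<ge> 1"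
  shows "F y \<bullet> ((1 / real K) *\<^sub>R (\<Sum>k<K. H k \<omega>) - y) + G ((1 / real K) *\<^sub>R (\<Sum>k<K. H k \<omega>)) - G y
    \<le> 1 / (2 * \<tau> * real K) * ((2 + 3 / (1 - \<gamma>)) * (norm (z0 - y))\<^sup>2 + (\<Sum>k<K. residual k \<omega>))"
proof -
  let ?w = "(1 / real K) *\<^sub>R (\<Sum>k<K. H k \<omega>)"
  have tel: "(\<Sum>k<n. 2 * \<tau> * (F y \<bullet> (H k \<omega> - y) + G (H k \<omega>) - G y)) + \<Psi> n \<omega> y
      \<le> \<Psi> 0 \<omega> y + (\<Sum>k<n. residual k \<omega>)" for n
  proof (induction n)
    case (Suc n)
    then show ?case using potential_step[OF y, of n \<omega>] by simp
  qed simp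
  have "0 \<le> \<Psi> K \<omega> y" using p_le_1 \<delta>_pos by (simp add: \<Psi>_def)
  moreover have "\<Psi> 0 \<omega> y \<le> (2 + 3 / (1 - \<gamma>)) * (norm (z0 - y))\<^sup>2"
  proof -
    have "\<Psi> 0 \<omega> y = (2 - p + 3 / (1 - \<gamma>)) * (norm (z0 - y))\<^sup>2"
      using \<gamma> by (simp add: \<Psi>_def \<delta>_def field_simps)
    also have "\<dots> \<le> (2 + 3 / (1 - \<gamma>)) * (norm (z0 - y))\<^sup>2"
      using p_pos by (intro mult_right_mono) auto
    finally show ?thesis .
  qed
  ultimately have sum: "2 * \<tau> * (\<Sum>k<K. F y \<bullet> (H k \<omega> - y) + G (H k \<omega>) - G y)
      \<le> (2 + 3 / (1 - \<gamma>)) * (norm (z0 - y))\<^sup>2 + (\<Sum>k<K. residual k \<omega>)"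
    using tel[of K] by (simp add: sum_distrib_left)
  have "G (\<Sum>k<K. (1 / real K) *\<^sub>R H k \<omega>) \<le> (\<Sum>k<K. 1 / real K * G (H k \<omega>))"
    by (rule convex_on_sum[OF _ _ gc.convex_on_rh]) (use K in_dom in \<open>auto simp: lessThan_empty_iff\<close>)
  then have "real K * G ?w \<le> (\<Sum>k<K. G (H k \<omega>))"
    using K by (simp add: scaleR_sum_right[symmetric] sum_distrib_left[symmetric] sum_divide_distrib[symmetric] field_simps)
  moreover have "real K * (F y \<bullet> (?w - y)) = (\<Sum>k<K. F y \<bullet> (H k \<omega> - y))"
    using K by (simp add: inner_diff_right inner_sum_right sum_subtractf right_diff_distrib)
  ultimately have "real K * (F y \<bullet> (?w - y) + G ?w - G y) \<le> (\<Sum>k<K. F y \<bullet> (H k \<omega> - y) + G (H k \<omega>) - G y)"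
    by (simp add: sum.distrib sum_subtractf algebra_simps)
  then have "2 * \<tau> * (real K * (F y \<bullet> (?w - y) + G ?w - G y)) \<le> 2 * \<tau> * (\<Sum>k<K. F y \<bullet> (H k \<omega> - y) + G (H k \<omega>) - G y)"
    using \<tau>_pos by (intro mult_left_mono) auto
  with sum have "(2 * \<tau> * real K) * (F y \<bullet> (?w - y) + G ?w - G y) \<le> (2 + 3 / (1 - \<gamma>)) * (norm (z0 - y))\<^sup>2 + (\<Sum>k<K. residual k \<omega>)"
    by simp
  then show ?thesis using K \<tau>_pos by (simp add: pos_le_divide_eq mult.commute)
qed

lemma average_in_dom: "K \<ge> 1 \<Longrightarrow> (1 / real K) *\<^sub>R (\<Sum>k<K. H k \<omega>) \<in> vi.dom_g"
proof -
  assume "K \<ge> 1"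
  then have "(\<Sum>k<K. (1 / real K) *\<^sub>R H k \<omega>) \<in> vi.dom_g"
    by (intro convex_sum gc.convex_dom) (use in_dom in auto)
  then show ?thesis by (simp add: scaleR_sum_right)
qed

end

section \<open>The rate\<close>

context eg_run begin

text \<open>Integrability of the gap follows from integrable bounds on both sides. Above, the pathwise
  bound of \<open>gap_sum_bound\<close> is uniform over \<open>C\<close>; below, a single point of \<open>C\<close> in the domain and an
  affine-in-norm minorant of \<open>g\<close> suffice.\<close>

lemma expected_gap:
  assumes C: "compact C" and ne: "C \<inter> effective_dom g \<noteq> {}" and K: "K \<ge> 1"
  shows "expectation_le M
      (\<lambda>\<omega>. gap g F C (eg_average g F Fo \<tau> (1 - p) z0 (\<lambda>k. \<xi> k \<omega>) (\<lambda>k. coin k \<omega>) K))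
      ((2 + 3 / (1 - \<gamma>)) / (2 * \<gamma>) * (L / (sqrt p * real K)) * (SUP z\<in>C. (norm (z0 - z))\<^sup>2))"
proof -
  define w where "w \<omega> = (1 / real K) *\<^sub>R (\<Sum>k<K. H k \<omega>)" for \<omega>
  define d where "d = (SUP z\<in>C. (norm (z0 - z))\<^sup>2)"
  define c where "c = 1 / (2 * \<tau> * real K)"
  define upper where "upper \<omega> = c * ((2 + 3 / (1 - \<gamma>)) * d + (\<Sum>k<K. residual k \<omega>))" for \<omega>
  obtain y0 where y0: "y0 \<in> C" "y0 \<in> vi.dom_g" using ne by blast
  obtain b a where minorant: "\<And>y. ereal (- a - b * norm y) \<le> g y"
    using gc.linear_minorant by metis
  define lower where "lower \<omega> = F y0 \<bullet> (w \<omega> - y0) + (- a - b * norm (w \<omega>)) - G y0" for \<omega>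
  have w: "w \<omega> \<in> vi.dom_g" for \<omega> unfolding w_def by (rule average_in_dom[OF K])
  have sq_w: "sq_integrable M w"
  proof -
    have "sq_integrable M (\<lambda>\<omega>. w \<omega>)" unfolding w_def
      by (intro sq_integrable_scaleR sq_integrable_sum finite_measure_axioms sq_H)
    then show ?thesis by simp
  qed
  have [measurable]: "w \<in> borel_measurable M" by (rule sq_integrable_measurable[OF sq_w])
  have "bdd_above ((\<lambda>z. (norm (z0 - z))\<^sup>2) ` C)"
    by (intro bounded_imp_bdd_above compact_imp_bounded compact_continuous_image C continuous_intros)
  then have d: "(norm (z0 - y))\<^sup>2 \<le> d" if "y \<in> C" for y
    unfolding d_def using that by (intro cSUP_upper)
  have c: "c > 0" using \<tau>_pos K by (simp add: c_def)
  have up: "gap g F C (w \<omega>) \<le> ereal (upper \<omega>)" for \<omega>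
  proof (rule gc.gap_upper[OF w])
    fix y assume y: "y \<in> C" "y \<in> vi.dom_g"
    have "F y \<bullet> (w \<omega> - y) + G (w \<omega>) - G y \<le> c * ((2 + 3 / (1 - \<gamma>)) * (norm (z0 - y))\<^sup>2 + (\<Sum>k<K. residual k \<omega>))"
      unfolding w_def c_def by (rule gap_sum_bound[OF y(2) K])
    also have "\<dots> \<le> upper \<omega>"
      unfolding upper_def using c \<gamma> d[OF y(1)] by (intro mult_left_mono add_right_mono) auto
    finally show "F y \<bullet> (w \<omega> - y) + G (w \<omega>) - G y \<le> upper \<omega>" .
  qed
  have lo: "ereal (lower \<omega>) \<le> gap g F C (w \<omega>)" for \<omega>
  proof -
    have "- a - b * norm (w \<omega>) \<le> G (w \<omega>)"
      using minorant[of "w \<omega>"] w[of \<omega>] by (auto elim!: gc.domE)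
    then have "ereal (lower \<omega>) \<le> ereal (F y0 \<bullet> (w \<omega> - y0) + G (w \<omega>) - G y0)"
      by (simp add: lower_def)
    also have "\<dots> \<le> gap g F C (w \<omega>)" by (rule gc.gap_lower[OF w y0])
    finally show ?thesis .
  qed
  have fin: "\<bar>gap g F C (w \<omega>)\<bar> \<noteq> \<infinity>" for \<omega>
    using up[of \<omega>] lo[of \<omega>] by (cases "gap g F C (w \<omega>)") auto
  have bounds: "lower \<omega> \<le> real_of_ereal (gap g F C (w \<omega>))" "real_of_ereal (gap g F C (w \<omega>)) \<le> upper \<omega>" for \<omega>
    using up[of \<omega>] lo[of \<omega>] by (cases "gap g F C (w \<omega>)"; simp)+
  have upper_int: "integrable M upper"
  proof -
    have "integrable M (\<lambda>\<omega>. upper \<omega>)"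
      unfolding upper_def by (intro integrable_mult_right Bochner_Integration.integrable_add
          Bochner_Integration.integrable_sum residual_integrable integrable_const)
    then show ?thesis by simp
  qed
  have lower_int: "integrable M lower"
  proof -
    note int_w = integrable_sq_integrable[OF sq_w]
    have "integrable M (\<lambda>\<omega>. lower \<omega>)"
      unfolding lower_def
      by (intro Bochner_Integration.integrable_add Bochner_Integration.integrable_diff
          integrable_mult_right integrable_inner_right integrable_norm int_w integrable_const)
    then show ?thesis by simp
  qed
  have gap_int: "integrable M (\<lambda>\<omega>. real_of_ereal (gap g F C (w \<omega>)))"
  proof (rule Bochner_Integration.integrable_bound)
    show "integrable M (\<lambda>\<omega>. \<bar>lower \<omega>\<bar> + \<bar>upper \<omega>\<bar>)"
      using lower_int upper_int by auto
    show "(\<lambda>\<omega>. real_of_ereal (gap g F C (w \<omega>))) \<in> borel_measurable M"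
      using gc.gap_measurable[of w M, OF _ w] by measurable
    show "AE \<omega> in M. norm (real_of_ereal (gap g F C (w \<omega>))) \<le> norm (\<bar>lower \<omega>\<bar> + \<bar>upper \<omega>\<bar>)"
    proof (rule AE_I2)
      fix \<omega> show "norm (real_of_ereal (gap g F C (w \<omega>))) \<le> norm (\<bar>lower \<omega>\<bar> + \<bar>upper \<omega>\<bar>)"
        using bounds[of \<omega>] unfolding real_norm_def by linarith
    qed
  qed
  have "expectation (\<lambda>\<omega>. real_of_ereal (gap g F C (w \<omega>))) \<le> expectation upper"
    by (rule integral_mono[OF gap_int upper_int]) (rule bounds)
  also have "\<dots> = c * ((2 + 3 / (1 - \<gamma>)) * d + (\<Sum>k<K. expectation (residual k)))"
    unfolding upper_def using residual_integrable by (simp add: prob_space)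
  also have "\<dots> \<le> c * ((2 + 3 / (1 - \<gamma>)) * d)"
    using c residual_expectation by (intro mult_left_mono) (auto intro: sum_nonpos)
  also have "\<dots> = (2 + 3 / (1 - \<gamma>)) / (2 * \<gamma>) * (L / (sqrt p * real K)) * d"
    using \<gamma> p_pos vi.L_pos K unfolding c_def \<tau> by (simp add: ac_simps)
  finally show ?thesis
    unfolding expectation_le_def eg_average_eq w_def[symmetric] d_def[symmetric]
    using fin gap_int by auto
qed

end

lemma eg_state_cong:
  assumes "\<And>j. F (snd (eg_state g F' Fo \<tau> \<alpha> z0 s b j)) = F' (snd (eg_state g F' Fo \<tau> \<alpha> z0 s b j))"
  shows "eg_state g F Fo \<tau> \<alpha> z0 s b k = eg_state g F' Fo \<tau> \<alpha> z0 s b k"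
  by (induction k)
     (use assms in \<open>simp_all add: case_prod_unfold Let_def eg_update_def eg_extrapolate_def\<close>)

lemma eg_average_cong:
  assumes F: "\<And>j. F (snd (eg_state g F' Fo \<tau> \<alpha> z0 s b j)) = F' (snd (eg_state g F' Fo \<tau> \<alpha> z0 s b j))"
  shows "eg_average g F Fo \<tau> \<alpha> z0 s b K = eg_average g F' Fo \<tau> \<alpha> z0 s b K"
  unfolding eg_average_def eg_half_def eg_state_cong[of F, OF F]
  by (simp add: case_prod_unfold eg_extrapolate_def F)

lemma (in closed_convex) gap_cong:
  assumes "w \<in> D" and F: "\<And>y. y \<in> D \<Longrightarrow> F y = F' y"
  shows "gap h F C w = gap h F' C w"
  unfolding gap_def
proof (rule SUP_cong)
  fix y show "ereal (F y \<bullet> (w - y)) + h w - h y = ereal (F' y \<bullet> (w - y)) + h w - h y"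
    using assms by (cases "y \<in> D") (auto simp: outside_dom elim!: domE)
qed simp

text \<open>Redefine \<open>F\<close> as \<open>0\<close> outside the domain of \<open>g\<close>. The new operator is Borel, since \<open>F\<close> is Lipschitz
  on the domain, which is a Borel set. All iterates lie in the domain and points of \<open>C\<close> outside it
  contribute \<open>- \<infinity>\<close> to the gap, so neither the iterates nor the gap change.\<close>

lemma expected_gap_bound:
  fixes g :: "'a::euclidean_space \<Rightarrow> ereal"
  assumes vi: "stochastic_vi Q g F Fo L" and sampling: "eg_sampling M Q p \<xi> coin"
    and C: "compact C" "C \<inter> effective_dom g \<noteq> {}" and z0: "z0 \<in> effective_dom g"
    and \<gamma>: "0 < \<gamma>" "\<gamma> < 1" and \<alpha>: "\<alpha> = 1 - p" and \<tau>: "\<tau> = sqrt (1 - \<alpha>) / L * \<gamma>"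
    and K: "K \<ge> 1"
  shows "expectation_le M
      (\<lambda>\<omega>. gap g F C (eg_average g F Fo \<tau> \<alpha> z0 (\<lambda>k. \<xi> k \<omega>) (\<lambda>k. coin k \<omega>) K))
      ((2 + 3 / (1 - \<gamma>)) / (2 * \<gamma>) * (L / (sqrt p * real K)) * (SUP z\<in>C. (norm (z0 - z))\<^sup>2))"
proof -
  interpret vi: stochastic_vi Q g F Fo L by (rule vi)
  interpret gc: closed_convex g using vi.proper vi.convex vi.lsc by unfold_locales
  define F' where "F' z = indicator (effective_dom g) z *\<^sub>R F z" for z
  have F': "F' z = F z" if "z \<in> effective_dom g" for z using that by (simp add: F'_def)
  have "L-lipschitz_on (effective_dom g) F"
    using vi.F_lipschitz vi.L_pos by (intro lipschitz_onI) (auto simp: dist_norm)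
  then have "F' \<in> borel_measurable borel"
    unfolding F'_def
    by (intro borel_measurable_continuous_on_indicator gc.dom_borel lipschitz_on_continuous_on)
  moreover have "stochastic_vi Q g F' Fo L"
  proof unfold_locales
    show "\<exists>zs\<in>effective_dom g. \<forall>z. 0 \<le> ereal (F' zs \<bullet> (z - zs)) + g z - g zs"
      using vi.solvable by (simp add: F' cong: bex_cong)
  qed (use vi.proper vi.convex vi.lsc vi.monotone vi.oracle_measurable vi.unbiased vi.L_pos
      vi.lipschitz_in_mean in \<open>auto simp: F'\<close>)
  ultimately interpret run: eg_run Q g F' Fo L M p \<xi> coin \<gamma> \<tau> z0
    using sampling \<gamma> z0 \<alpha> \<tau> by (simp add: eg_run_def eg_run_axioms_def)
  have "eg_average g F Fo \<tau> \<alpha> z0 (\<lambda>k. \<xi> k \<omega>) (\<lambda>k. coin k \<omega>) K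
      = eg_average g F' Fo \<tau> \<alpha> z0 (\<lambda>k. \<xi> k \<omega>) (\<lambda>k. coin k \<omega>) K" for \<omega>
    unfolding \<alpha> by (rule eg_average_cong) (simp add: run.eg_state_eq F' run.in_dom)
  moreover have "gap g F C (eg_average g F' Fo \<tau> \<alpha> z0 (\<lambda>k. \<xi> k \<omega>) (\<lambda>k. coin k \<omega>) K)
      = gap g F' C (eg_average g F' Fo \<tau> \<alpha> z0 (\<lambda>k. \<xi> k \<omega>) (\<lambda>k. coin k \<omega>) K)" for \<omega>
    unfolding \<alpha> by (rule gc.gap_cong) (simp_all add: run.eg_average_eq run.average_in_dom[OF K] F')
  ultimately show ?thesis using run.expected_gap[OF C K] by (simp add: \<alpha>)
qed

theorem theorem2p5:
  shows
    "(\<forall>\<gamma>. 0 < \<gamma> \<and> \<gamma> < 1 \<longrightarrow>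
      (\<exists>c>0. \<forall>(M :: 'w measure) (Q :: 's measure) (g :: 'a::euclidean_space \<Rightarrow> ereal)
          (F :: 'a \<Rightarrow> 'a) (Fo :: 's \<Rightarrow> 'a \<Rightarrow> 'a) (L :: real) (C :: 'a set)
          (p :: real) (\<alpha> :: real) (\<tau> :: real) (z0 :: 'a)
          (\<xi> :: nat \<Rightarrow> 'w \<Rightarrow> 's) (coin :: nat \<Rightarrow> 'w \<Rightarrow> bool).
        stochastic_vi Q g F Fo L \<longrightarrow> eg_sampling M Q p \<xi> coin \<longrightarrow>
        compact C \<longrightarrow> C \<inter> effective_dom g \<noteq> {} \<longrightarrow> z0 \<in> effective_dom g \<longrightarrow>
        \<alpha> = 1 - p \<longrightarrow> \<tau> = sqrt (1 - \<alpha>) / L * \<gamma> \<longrightarrow>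
        (\<forall>K\<ge>1. expectation_le M
            (\<lambda>\<omega>. gap g F C (eg_average g F Fo \<tau> \<alpha> z0 (\<lambda>k. \<xi> k \<omega>) (\<lambda>k. coin k \<omega>) K))
            (c * (L / (sqrt p * real K)) * (SUP z\<in>C. (norm (z0 - z))\<^sup>2)))))
     \<and>
     (\<forall>(M :: 'w measure) (Q :: 's measure) (g :: 'a \<Rightarrow> ereal)
          (F :: 'a \<Rightarrow> 'a) (Fo :: 's \<Rightarrow> 'a \<Rightarrow> 'a) (L :: real) (C :: 'a set)
          (p :: real) (\<alpha> :: real) (\<tau> :: real) (z0 :: 'a)
          (\<xi> :: nat \<Rightarrow> 'w \<Rightarrow> 's) (coin :: nat \<Rightarrow> 'w \<Rightarrow> bool).
        stochastic_vi Q g F Fo L \<longrightarrow> eg_sampling M Q p \<xi> coin \<longrightarrow>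
        compact C \<longrightarrow> C \<inter> effective_dom g \<noteq> {} \<longrightarrow> z0 \<in> effective_dom g \<longrightarrow>
        \<alpha> = 1 - p \<longrightarrow> \<tau> = sqrt p / (2 * L) \<longrightarrow>
        (\<forall>K\<ge>1. expectation_le M
            (\<lambda>\<omega>. gap g F C (eg_average g F Fo \<tau> \<alpha> z0 (\<lambda>k. \<xi> k \<omega>) (\<lambda>k. coin k \<omega>) K))
            (17.5 * L / (sqrt p * real K) * (SUP z\<in>C. (norm (z0 - z))\<^sup>2))))"
proof (intro conjI allI impI)
  fix \<gamma> :: real assume \<gamma>: "0 < \<gamma> \<and> \<gamma> < 1"
  show "\<exists>c>0. \<forall>(M :: 'w measure) (Q :: 's measure) (g :: 'a \<Rightarrow> ereal)
          (F :: 'a \<Rightarrow> 'a) (Fo :: 's \<Rightarrow> 'a \<Rightarrow> 'a) (L :: real) (C :: 'a set)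
          (p :: real) (\<alpha> :: real) (\<tau> :: real) (z0 :: 'a)
          (\<xi> :: nat \<Rightarrow> 'w \<Rightarrow> 's) (coin :: nat \<Rightarrow> 'w \<Rightarrow> bool).
        stochastic_vi Q g F Fo L \<longrightarrow> eg_sampling M Q p \<xi> coin \<longrightarrow>
        compact C \<longrightarrow> C \<inter> effective_dom g \<noteq> {} \<longrightarrow> z0 \<in> effective_dom g \<longrightarrow>
        \<alpha> = 1 - p \<longrightarrow> \<tau> = sqrt (1 - \<alpha>) / L * \<gamma> \<longrightarrow>
        (\<forall>K\<ge>1. expectation_le M
            (\<lambda>\<omega>. gap g F C (eg_average g F Fo \<tau> \<alpha> z0 (\<lambda>k. \<xi> k \<omega>) (\<lambda>k. coin k \<omega>) K))
            (c * (L / (sqrt p * real K)) * (SUP z\<in>C. (norm (z0 - z))\<^sup>2)))"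
  proof (intro exI[of _ "(2 + 3 / (1 - \<gamma>)) / (2 * \<gamma>)"] conjI allI impI)
    show "0 < (2 + 3 / (1 - \<gamma>)) / (2 * \<gamma>)"
      using \<gamma> by (intro divide_pos_pos add_pos_pos) auto
  qed (rule expected_gap_bound; use \<gamma> in blast)
next
  fix M :: "'w measure" and Q :: "'s measure" and g :: "'a \<Rightarrow> ereal" and F :: "'a \<Rightarrow> 'a"
    and Fo :: "'s \<Rightarrow> 'a \<Rightarrow> 'a" and L p \<alpha> \<tau> :: real and C :: "'a set" and z0 :: 'a
    and \<xi> :: "nat \<Rightarrow> 'w \<Rightarrow> 's" and coin :: "nat \<Rightarrow> 'w \<Rightarrow> bool" and K :: nat
  assume vi: "stochastic_vi Q g F Fo L" and sampling: "eg_sampling M Q p \<xi> coin"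
    and C: "compact C" "C \<inter> effective_dom g \<noteq> {}" and z0: "z0 \<in> effective_dom g"
    and \<alpha>: "\<alpha> = 1 - p" and \<tau>: "\<tau> = sqrt p / (2 * L)" and K: "K \<ge> 1"
  define d where "d = (SUP z\<in>C. (norm (z0 - z))\<^sup>2)"
  obtain y where y: "y \<in> C" using C by blast
  have "bdd_above ((\<lambda>z. (norm (z0 - z))\<^sup>2) ` C)"
    by (intro bounded_imp_bdd_above compact_imp_bounded compact_continuous_image C continuous_intros)
  then have "(norm (z0 - y))\<^sup>2 \<le> d" unfolding d_def by (intro cSUP_upper y)
  then have d: "0 \<le> d" using zero_le_power2 order_trans by blast
  have L: "0 < L" using vi by (rule stochastic_vi.L_pos)
  have p: "0 < p" using sampling by (rule eg_sampling.p_pos)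
  \<comment> \<open>At \<open>\<gamma> = 1/2\<close> the constant of \<open>expected_gap_bound\<close> is \<open>8\<close>.\<close>
  have "(2 + 3 / (1 - 1/2)) / (2 * (1/2)) * (L / (sqrt p * real K)) * d \<le> 17.5 * L / (sqrt p * real K) * d"
    using d L p K by (intro mult_right_mono) (simp_all add: field_simps)
  moreover have "\<tau> = sqrt (1 - \<alpha>) / L * (1/2)" by (simp add: \<tau> \<alpha>)
  ultimately show "expectation_le M
            (\<lambda>\<omega>. gap g F C (eg_average g F Fo \<tau> \<alpha> z0 (\<lambda>k. \<xi> k \<omega>) (\<lambda>k. coin k \<omega>) K))
            (17.5 * L / (sqrt p * real K) * (SUP z\<in>C. (norm (z0 - z))\<^sup>2))"
    using expected_gap_bound[OF vi sampling C z0 _ _ \<alpha> _ K, of "1/2" \<tau>]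
    unfolding expectation_le_def d_def[symmetric] by auto
qed

end
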